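(* Let $E$ be a Banach space whose dual $E'$ has type 2, and let $1\le r\le2$. Then $$\mathcal{L}(\ell_1,E;\mathbb{K})=\Pi_{(1;2,1)}(\ell_1,E;\mathbb{K})=\Pi_{(r;2,r)}(\ell_1,E;\mathbb{K}).$$ In particular, if $1<q\le2$ and $1\le r\le2$, then $$\mathcal{L}(\ell_1,\ell_q;\mathbb{K})=\Pi_{(1;2,1)}(\ell_1,\ell_q;\mathbb{K})=\Pi_{(r;2,r)}(\ell_1,\ell_q;\mathbb{K}).$$
   Context: Banach spaces are over $\mathbb{K}=\mathbb{R}$ or $\mathbb{C}$; $E'$ is the topological dual of $E$ and $B_{E'}$ its closed unit ball. $\mathcal{L}(E_1,E_2;\mathbb{K})$ is the space of continuous bilinear forms on $E_1\times E_2$. For a finite family, $\|(x_j)\|_{\ell_p^w(E)}=\sup_{\varphi\in B_{E'}}(\sum_j|\varphi(x_j)|^p)^{1/p}$. For $0<p,p_1,p_2<\infty$ with $\frac1p\le\frac1{p_1}+\frac1{p_2}$, $\Pi_{(p;p_1,p_2)}(E_1,E_2;\mathbb{K})$ is the space of absolutely $(p;p_1,p_2)$-summing bilinear forms, i.e. those $A\in\mathcal{L}(E_1,E_2;\mathbb{K})$ for which there is $C>0$ with $\big(\sum_{j=1}^m|A(x_j^1,x_j^2)|^p\big)^{1/p}\le C\prod_{i=1}^2\|(x_j^i)_{j=1}^m\|_{\ell_{p_i}^w(E_i)}$ for all finite families $x_1^i,\ldots,x_m^i\in E_i$, $i=1,2$. *)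

theory Defs
  imports "HOL-Analysis.Analysis" "HOL-Library.Function_Algebras"
begin

text \<open>
  The scalar field is the real or the complex field. The class makes a single statement cover
  both cases: up to isometric field isomorphism its only members are \<^typ>\<open>real\<close> and
  \<^typ>\<open>complex\<close>, and both are instances.
\<close>

class real_or_complex = real_normed_field +
  assumes real_or_complex:
    "(\<exists>f :: real \<Rightarrow> 'a. bij f \<and> (\<forall>x y. f (x + y) = f x + f y) \<and>
        (\<forall>x y. f (x * y) = f x * f y) \<and> (\<forall>x. norm (f x) = norm x)) \<or>
     (\<exists>f :: complex \<Rightarrow> 'a. bij f \<and> (\<forall>x y. f (x + y) = f x + f y) \<and>
        (\<forall>x y. f (x * y) = f x * f y) \<and> (\<forall>x. norm (f x) = norm x))"

instance real :: real_or_complex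
  by standard (rule disjI1, rule exI[of _ id], simp)

instance complex :: real_or_complex
  by standard (rule disjI2, rule exI[of _ id], simp)

text \<open>
  The type class \<^class>\<open>banach\<close> only knows real scalars, and the exponent of a sequence
  space cannot be a parameter of a type. Normed spaces are therefore linear subspaces
  \<open>vecs E\<close> of an ambient vector space, given by a type, with a norm \<open>vnorm E\<close>
  whose values outside \<open>vecs E\<close> are irrelevant.
\<close>

record ('k, 'a) nspace =
  vecs :: "'a set"
  smul :: "'k \<Rightarrow> 'a \<Rightarrow> 'a"
  vnorm :: "'a \<Rightarrow> real"

text \<open>The library's metric spaces require symmetry and nonnegativity on the whole type,
  so the distance is cut off outside the space.\<close>

definition vdist :: "('k, 'a::ab_group_add) nspace \<Rightarrow> 'a \<Rightarrow> 'a \<Rightarrow> real" where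
  "vdist E x y = (if x \<in> vecs E \<and> y \<in> vecs E then vnorm E (x - y) else 0)"

definition vtopology :: "('k, 'a::ab_group_add) nspace \<Rightarrow> 'a topology" where
  "vtopology E = Metric_space.mtopology (vecs E) (vdist E)"

locale normed_space =
  fixes E :: "('k::real_or_complex, 'a::ab_group_add) nspace"
  assumes vector_space: "vector_space (smul E)"
    and subspace: "module.subspace (smul E) (vecs E)"
    and norm_nonneg: "x \<in> vecs E \<Longrightarrow> 0 \<le> vnorm E x"
    and norm_eq_0: "x \<in> vecs E \<Longrightarrow> vnorm E x = 0 \<longleftrightarrow> x = 0"
    and norm_smul: "x \<in> vecs E \<Longrightarrow> vnorm E (smul E c x) = norm c * vnorm E x"
    and norm_triangle:
      "x \<in> vecs E \<Longrightarrow> y \<in> vecs E \<Longrightarrow> vnorm E (x + y) \<le> vnorm E x + vnorm E y"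
begin

sublocale vector_space "smul E"
  by (rule vector_space)

sublocale Metric_space "vecs E" "vdist E"
proof
  have diff: "x - y \<in> vecs E" if "x \<in> vecs E" "y \<in> vecs E" for x y
    using that subspace_diff subspace by blast
  show "0 \<le> vdist E x y" for x y
    by (simp add: vdist_def diff norm_nonneg)
  show "vdist E x y = vdist E y x" for x y
    using norm_smul[OF diff, of x y "-1"] by (simp add: vdist_def)
  show "vdist E x y = 0 \<longleftrightarrow> x = y" if "x \<in> vecs E" "y \<in> vecs E" for x y
    using that by (simp add: vdist_def diff norm_eq_0)
  show "vdist E x z \<le> vdist E x y + vdist E y z"
    if "x \<in> vecs E" "y \<in> vecs E" "z \<in> vecs E" for x y z
    using that norm_triangle[OF diff diff, of x y y z] by (simp add: vdist_def)
qed

end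

locale banach_space = normed_space +
  assumes complete: "Metric_space.mcomplete (vecs E) (vdist E)"

text \<open>Functions on a space are set to \<open>0\<close> outside it, which makes the representation of
  functionals and of bilinear forms unique.\<close>

definition linear_form ::
  "('k::real_or_complex, 'a::ab_group_add) nspace \<Rightarrow> ('a \<Rightarrow> 'k) \<Rightarrow> bool" where
  "linear_form E f \<longleftrightarrow>
     (\<forall>x\<in>vecs E. \<forall>y\<in>vecs E. f (x + y) = f x + f y) \<and>
     (\<forall>c. \<forall>x\<in>vecs E. f (smul E c x) = c * f x) \<and>
     (\<forall>x. x \<notin> vecs E \<longrightarrow> f x = 0)"

definition dual ::
  "('k::real_or_complex, 'a::ab_group_add) nspace \<Rightarrow> ('k, 'a \<Rightarrow> 'k) nspace" where
  "dual E = \<lparr>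
     vecs = {f. linear_form E f \<and> continuous_map (vtopology E) euclidean f},
     smul = (\<lambda>c f x. c * f x),
     vnorm = (\<lambda>f. SUP x\<in>{x \<in> vecs E. vnorm E x \<le> 1}. norm (f x))\<rparr>"

definition continuous_bilinear_forms ::
  "('k::real_or_complex, 'a::ab_group_add) nspace \<Rightarrow> ('k, 'b::ab_group_add) nspace
     \<Rightarrow> ('a \<Rightarrow> 'b \<Rightarrow> 'k) set" where
  "continuous_bilinear_forms E\<^sub>1 E\<^sub>2 = {A.
     (\<forall>x. linear_form E\<^sub>2 (\<lambda>y. A x y)) \<and> (\<forall>y. linear_form E\<^sub>1 (\<lambda>x. A x y)) \<and>
     continuous_map (prod_topology (vtopology E\<^sub>1) (vtopology E\<^sub>2)) euclidean
       (\<lambda>(x, y). A x y)}"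

text \<open>The finite family is \<open>x 0, \<dots>, x (m - 1)\<close>.\<close>

definition weak_norm ::
  "real \<Rightarrow> ('k::real_or_complex, 'a::ab_group_add) nspace \<Rightarrow> nat \<Rightarrow> (nat \<Rightarrow> 'a) \<Rightarrow> real" where
  "weak_norm p E m x =
     (SUP \<phi>\<in>{\<phi> \<in> vecs (dual E). vnorm (dual E) \<phi> \<le> 1}.
        (\<Sum>j<m. norm (\<phi> (x j)) powr p) powr (1 / p))"

text \<open>Meant for \<open>p, p\<^sub>1, p\<^sub>2 > 0\<close> with \<open>1 / p \<le> 1 / p\<^sub>1 + 1 / p\<^sub>2\<close>.\<close>

definition summing_forms ::
  "real \<Rightarrow> real \<Rightarrow> real \<Rightarrow> ('k::real_or_complex, 'a::ab_group_add) nspace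
     \<Rightarrow> ('k, 'b::ab_group_add) nspace \<Rightarrow> ('a \<Rightarrow> 'b \<Rightarrow> 'k) set" where
  "summing_forms p p\<^sub>1 p\<^sub>2 E\<^sub>1 E\<^sub>2 = {A \<in> continuous_bilinear_forms E\<^sub>1 E\<^sub>2.
     \<exists>C>0. \<forall>m x y. (\<forall>j<m. x j \<in> vecs E\<^sub>1 \<and> y j \<in> vecs E\<^sub>2) \<longrightarrow>
       (\<Sum>j<m. norm (A (x j) (y j)) powr p) powr (1 / p)
         \<le> C * (weak_norm p\<^sub>1 E\<^sub>1 m x * weak_norm p\<^sub>2 E\<^sub>2 m y)}"

text \<open>Rademacher type \<open>p\<close>. The mean over the \<open>2 ^ n\<close> choices of signs is the expectation of
  \<open>\<parallel>\<Sum>j<n. \<epsilon> j * x j\<parallel>\<^sup>2\<close> for independent random signs \<open>\<epsilon> j\<close>.\<close>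

definition has_type :: "real \<Rightarrow> ('k::real_or_complex, 'a::ab_group_add) nspace \<Rightarrow> bool" where
  "has_type p E \<longleftrightarrow> (\<exists>C. \<forall>n x. (\<forall>j<n. x j \<in> vecs E) \<longrightarrow>
     sqrt ((\<Sum>\<epsilon>\<in>{..<n} \<rightarrow>\<^sub>E {-1, 1}. (vnorm E (\<Sum>j<n. smul E (\<epsilon> j) (x j)))\<^sup>2) / 2 ^ n)
       \<le> C * (\<Sum>j<n. vnorm E (x j) powr p) powr (1 / p))"

definition lp :: "real \<Rightarrow> ('k::real_or_complex, nat \<Rightarrow> 'k) nspace" where
  "lp p = \<lparr>
     vecs = {x. summable (\<lambda>n. norm (x n) powr p)},
     smul = (\<lambda>c x n. c * x n),
     vnorm = (\<lambda>x. (\<Sum>n. norm (x n) powr p) powr (1 / p))\<rparr>"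

end

theory Submission
  imports Defs
begin

text \<open>
  The exponent \<open>r\<close> reduces to \<open>1\<close> by Hoelder's inequality. For \<open>r = 1\<close> write
  \<open>A (x i) (y i) = (\<Sum>k. a i k * \<phi> k (y i))\<close> with \<open>a i k = x i k\<close> and \<open>\<phi> k = A (e k)\<close>.
  Khinchine's inequality bounds \<open>\<Sum>k. sqrt (\<Sum>i. l i * \<bar>a i k\<bar>\<^sup>2)\<close> by the weak \<open>2\<close>-norm of \<open>x\<close>
  for all weights \<open>l\<close> in the simplex. At a maximising \<open>l\<close>, the first-order condition yields a
  probability vector \<open>\<mu>\<close> for which every \<open>\<Sum>k. \<bar>a i k\<bar>\<^sup>2 / \<mu> k\<close> is controlled, so that
  \<open>\<bar>A (x i) (y i)\<bar>\<close> is at most a constant times \<open>sqrt (\<Sum>k. \<mu> k * \<bar>\<phi> k (y i)\<bar>\<^sup>2)\<close>. By Khinchine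
  again, the sum of these over \<open>i\<close> is at most twice the mean of
  \<open>\<Sum>i. \<bar>(\<Sum>k. \<epsilon> k * sqrt (\<mu> k) * \<phi> k) (y i)\<bar>\<close>, and type \<open>2\<close> of the dual bounds the mean norm
  of the random functional. For \<open>\<ell>\<^sub>q\<close> with \<open>1 < q \<le> 2\<close>, type \<open>2\<close> of the dual follows by duality
  from the two-point inequality
  \<open>\<parallel>a\<parallel>\<^sup>2 + (q - 1) * \<parallel>b\<parallel>\<^sup>2 \<le> (\<parallel>a + b\<parallel>\<^sup>2 + \<parallel>a - b\<parallel>\<^sup>2) / 2\<close>.
\<close>

section \<open>Inequalities for real powers\<close>

text \<open>After division by the weighted mean \<open>z\<close>, each power lies below its tangent
  at \<open>1\<close>, which is Young's inequality. The weighted average of the tangents is exactly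
  \<open>1\<close>.\<close>

lemma powr_concave:
  fixes x y h u v :: real
  assumes "0 \<le> x" "0 \<le> y" "0 \<le> u" "0 \<le> v" "u + v = 1" "0 < h" "h \<le> 1"
  shows "u * x powr h + v * y powr h \<le> (u * x + v * y) powr h"
proof (cases "u * x + v * y = 0")
  case True
  then have "u * x = 0" "v * y = 0"
    using assms by (simp_all add: add_nonneg_eq_0_iff)
  then show ?thesis
    using assms by auto
next
  case False
  define z where "z = u * x + v * y"
  have z: "z > 0"
    using False assms by (simp add: z_def order_less_le)
  have tangent: "(w / z) powr h \<le> h * (w / z) + (1 - h)" if "w \<ge> 0" for w
  proof (cases "w = 0")
    case False
    then show ?thesis
      using Youngs_inequality_0[of h "1 - h" "w / z" 1] that z assms by simp
  qed (use assms in auto)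
  have "u * (x / z) powr h + v * (y / z) powr h
      \<le> u * (h * (x / z) + (1 - h)) + v * (h * (y / z) + (1 - h))"
    using assms by (intro add_mono mult_left_mono tangent)
  also have "\<dots> = h * ((u * x + v * y) / z) + (u + v) * (1 - h)"
    by (simp add: algebra_simps add_divide_distrib)
  also have "\<dots> = 1"
    using z assms by (simp flip: z_def)
  finally have "u * (x powr h / z powr h) + v * (y powr h / z powr h) \<le> 1"
    using assms z by (simp add: powr_divide)
  then have "(u * x powr h + v * y powr h) / z powr h \<le> 1"
    by (simp add: add_divide_distrib)
  then show ?thesis
    using z by (simp add: z_def[symmetric] divide_le_eq)
qed

text \<open>Concavity for the exponent \<open>1 / p\<close>, applied to \<open>x powr p\<close> and
  \<open>y powr p\<close>.\<close>

lemma powr_convex: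
  fixes x y p u v :: real
  assumes "0 \<le> x" "0 \<le> y" "0 \<le> u" "0 \<le> v" "u + v = 1" "1 \<le> p"
  shows "(u * x + v * y) powr p \<le> u * x powr p + v * y powr p"
proof -
  have "u * x + v * y \<le> (u * x powr p + v * y powr p) powr (1 / p)"
    using powr_concave[of "x powr p" "y powr p" u v "1 / p"] assms by (simp add: powr_powr)
  then have "(u * x + v * y) powr p \<le> ((u * x powr p + v * y powr p) powr (1 / p)) powr p"
    using assms by (intro powr_mono2) auto
  then show ?thesis
    using assms by (simp add: powr_powr)
qed

text \<open>With equal sums, \<open>x\<close> and \<open>y\<close> are convex combinations of
  \<open>X\<close> and \<open>Y\<close> with the two weights exchanged; add two instances of
  concavity.\<close>

lemma powr_spread:
  fixes x y X Y h :: real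
  assumes "0 \<le> Y" "Y \<le> x" "x \<le> X" "x + y = X + Y" "0 < h" "h \<le> 1"
  shows "X powr h + Y powr h \<le> x powr h + y powr h"
proof (cases "X = Y")
  case False
  define u where "u = (x - Y) / (X - Y)"
  define v where "v = (X - x) / (X - Y)"
  have pos: "X - Y > 0"
    using False assms by simp
  have uv: "0 \<le> u" "0 \<le> v" "u + v = 1"
    using pos assms by (auto simp: u_def v_def simp flip: add_divide_distrib)
  have "u * X + v * Y = ((x - Y) * X + (X - x) * Y) / (X - Y)"
    by (simp add: u_def v_def add_divide_distrib)
  also have "(x - Y) * X + (X - x) * Y = x * (X - Y)"
    by (simp add: algebra_simps)
  finally have x: "u * X + v * Y = x"
    using pos by simp
  have "(u + v) * (X + Y) = x + y"
    using uv assms by simp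
  then have y: "v * X + u * Y = y"
    using x by (simp add: algebra_simps)
  have "u * X powr h + v * Y powr h \<le> x powr h"
    using powr_concave[of X Y u v h] uv assms x by simp
  moreover have "v * X powr h + u * Y powr h \<le> y powr h"
    using powr_concave[of X Y v u h] uv assms y by simp
  moreover have "u * X powr h + v * Y powr h + (v * X powr h + u * Y powr h)
      = (u + v) * (X powr h + Y powr h)"
    by (simp add: algebra_simps)
  ultimately show ?thesis
    using uv by simp
qed (use assms in auto)

lemma Holder_sum:
  fixes f g :: "'i \<Rightarrow> real"
  assumes "finite I" "\<And>i. i \<in> I \<Longrightarrow> 0 \<le> f i" "\<And>i. i \<in> I \<Longrightarrow> 0 \<le> g i"
    and pq: "1 < p" "1 < q" "1 / p + 1 / q = 1"
  shows "(\<Sum>i\<in>I. f i * g i) \<le> (\<Sum>i\<in>I. f i powr p) powr (1 / p) * (\<Sum>i\<in>I. g i powr q) powr (1 / q)"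
proof -
  define F where "F = (\<Sum>i\<in>I. f i powr p)"
  define G where "G = (\<Sum>i\<in>I. g i powr q)"
  have nonneg: "F \<ge> 0" "G \<ge> 0"
    by (auto simp: F_def G_def sum_nonneg)
  consider "F = 0" | "G = 0" | "F > 0" "G > 0"
    using nonneg by linarith
  then show ?thesis
  proof cases
    case 1
    then have "\<forall>i\<in>I. f i powr p = 0"
      using assms(1) by (simp add: F_def sum_nonneg_eq_0_iff)
    then show ?thesis
      by (simp flip: F_def G_def)
  next
    case 2
    then have "\<forall>i\<in>I. g i powr q = 0"
      using assms(1) by (simp add: G_def sum_nonneg_eq_0_iff)
    then show ?thesis
      by (simp flip: F_def G_def)
  next
    case 3
    let ?F = "F powr (1 / p)" and ?G = "G powr (1 / q)"
    have "(\<Sum>i\<in>I. (f i / ?F) * (g i / ?G))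
        \<le> (\<Sum>i\<in>I. (f i / ?F) powr p / p + (g i / ?G) powr q / q)"
      using assms by (intro sum_mono Youngs_inequality) auto
    also have "\<dots> = (\<Sum>i\<in>I. f i powr p) / F / p + (\<Sum>i\<in>I. g i powr q) / G / q"
      using assms 3 by (simp add: powr_divide powr_powr sum.distrib sum_divide_distrib)
    also have "\<dots> = 1"
      using 3 pq by (simp flip: F_def G_def)
    finally have "(\<Sum>i\<in>I. f i * g i) / (?F * ?G) \<le> 1"
      by (simp add: sum_divide_distrib)
    then show ?thesis
      using 3 by (simp add: divide_le_eq F_def[symmetric] G_def[symmetric])
  qed
qed

section \<open>Two-point inequalities for real powers\<close>

text \<open>Both sides vanish at \<open>t = 0\<close>, and the derivatives compare by AM-GM: the two
  powers in the derivative have product \<open>(1 - x\<^sup>2) powr (p - 1)\<close>, which is at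
  least \<open>1\<close> because its exponent is not positive.\<close>

lemma two_point_powr_aux:
  fixes p t :: real
  assumes p: "0 < p" "p \<le> 1" and t: "0 \<le> t" "t < 1"
  shows "2 * p * t \<le> (1 + t) powr p - (1 - t) powr p"
proof -
  define g where "g t = (1 + t) powr p - (1 - t) powr p - 2 * p * t" for t
  have "g 0 \<le> g t"
  proof (rule DERIV_nonneg_imp_nondecreasing[OF t(1)])
    fix x assume x: "0 \<le> x" "x \<le> t"
    let ?a = "(1 + x) powr (p - 1)" and ?b = "(1 - x) powr (p - 1)"
    have der: "(g has_real_derivative p * ?a + p * ?b - 2 * p) (at x)"
      unfolding g_def using x t by (auto intro!: derivative_eq_intros)
    have "x\<^sup>2 < 1"
      using x t by (simp add: power_less_one_iff abs_square_less_1)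
    then have "(1 - x\<^sup>2) powr 0 \<le> (1 - x\<^sup>2) powr (p - 1)"
      using p by (intro powr_mono') (auto simp: power_le_one)
    also have "(1 - x\<^sup>2) powr (p - 1) = ?a * ?b"
      using x t by (simp add: power2_eq_square algebra_simps flip: powr_mult)
    finally have ab: "1 \<le> ?a * ?b"
      using \<open>x\<^sup>2 < 1\<close> by simp
    have "(2::real)\<^sup>2 \<le> (?a + ?b)\<^sup>2"
      using ab zero_le_power2[of "?a - ?b"] by (simp add: power2_eq_square algebra_simps)
    then have "2 \<le> ?a + ?b"
      by (rule power2_le_imp_le) simp
    then have "p * 2 \<le> p * (?a + ?b)"
      using p by (intro mult_left_mono) auto
    then show "\<exists>y. (g has_real_derivative y) (at x) \<and> 0 \<le> y"
      using der by (intro exI conjI) (auto simp: algebra_simps)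
  qed
  then show ?thesis
    by (simp add: g_def)
qed

text \<open>One differentiation reduces this to \<open>two_point_powr_aux\<close> at exponent
  \<open>q - 1\<close>. Derivatives are taken at interior points only, since \<open>1 - t\<close>
  may reach \<open>0\<close>; continuity covers the endpoints.\<close>

lemma two_point_powr:
  fixes q t :: real
  assumes q: "1 < q" "q \<le> 2" and t: "0 \<le> t" "t \<le> 1"
  shows "2 + q * (q - 1) * t\<^sup>2 \<le> (1 + t) powr q + (1 - t) powr q"
proof -
  define g where "g t = (1 + t) powr q + (1 - t) powr q - q * (q - 1) * t\<^sup>2" for t
  have "g 0 \<le> g t"
  proof (rule DERIV_nonneg_imp_increasing_open[OF t(1)])
    fix x assume x: "0 < x" "x < t"
    have "(g has_real_derivative
        q * (1 + x) powr (q - 1) - q * (1 - x) powr (q - 1) - q * (q - 1) * (2 * x)) (at x)"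
      unfolding g_def using x t by (auto intro!: derivative_eq_intros)
    moreover have "q * (2 * (q - 1) * x) \<le> q * ((1 + x) powr (q - 1) - (1 - x) powr (q - 1))"
      using q x t by (intro mult_left_mono two_point_powr_aux) auto
    ultimately show "\<exists>y. (g has_real_derivative y) (at x) \<and> 0 \<le> y"
      by (intro exI conjI) (auto simp: algebra_simps)
  next
    show "continuous_on {0..t} g"
      unfolding g_def using q t
      by (intro continuous_on_diff continuous_on_add continuous_on_powr' continuous_on_mult
          continuous_on_power continuous_on_const continuous_on_id) auto
  qed
  then show ?thesis
    by (simp add: g_def)
qed

text \<open>The scalar form of 2-uniform convexity. By homogeneity the larger variable becomes
  \<open>1\<close>; the left-hand power then lies below its tangent, which
  \<open>two_point_powr\<close> bounds.\<close>

lemma two_point_real: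
  fixes q x y :: real
  assumes q: "1 < q" "q \<le> 2" and "0 \<le> x" "0 \<le> y"
  shows "2 * (x\<^sup>2 + (q - 1) * y\<^sup>2) powr (q / 2) \<le> (x + y) powr q + \<bar>x - y\<bar> powr q"
proof -
  have main: "2 * (x\<^sup>2 + (q - 1) * y\<^sup>2) powr (q / 2) \<le> (x + y) powr q + (x - y) powr q"
    if "0 \<le> y" "y \<le> x" for x y :: real
  proof (cases "x = 0")
    case True
    then show ?thesis
      using that by simp
  next
    case False
    then have x: "x > 0"
      using that by simp
    define t where "t = y / x"
    have t: "0 \<le> t" "t \<le> 1" and y: "y = x * t"
      using x that by (auto simp: t_def)
    have "(1 + (q - 1) * t\<^sup>2) powr (q / 2) * 1 powr (1 - q / 2)
        \<le> (q / 2) * (1 + (q - 1) * t\<^sup>2) + (1 - q / 2) * 1"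
      using q by (intro Youngs_inequality_0 add_pos_nonneg) auto
    then have "2 * (1 + (q - 1) * t\<^sup>2) powr (q / 2) \<le> 2 + q * (q - 1) * t\<^sup>2"
      by (simp add: field_simps)
    also have "\<dots> \<le> (1 + t) powr q + (1 - t) powr q"
      using q t by (rule two_point_powr)
    finally have "x powr q * (2 * (1 + (q - 1) * t\<^sup>2) powr (q / 2))
        \<le> x powr q * ((1 + t) powr q + (1 - t) powr q)"
      by (rule mult_left_mono) simp
    moreover have "x powr q * (1 + (q - 1) * t\<^sup>2) powr (q / 2) = (x\<^sup>2 + (q - 1) * y\<^sup>2) powr (q / 2)"
    proof -
      have "x powr q = (x\<^sup>2) powr (q / 2)"
        using x by (simp add: powr_powr flip: powr_numeral)
      then have "x powr q * (1 + (q - 1) * t\<^sup>2) powr (q / 2)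
          = (x\<^sup>2 * (1 + (q - 1) * t\<^sup>2)) powr (q / 2)"
        using q by (simp add: powr_mult)
      then show ?thesis
        by (simp add: y algebra_simps power_mult_distrib)
    qed
    moreover have "x powr q * (1 + t) powr q = (x + y) powr q" "x powr q * (1 - t) powr q = (x - y) powr q"
      using x t by (simp_all add: y algebra_simps flip: powr_mult)
    ultimately show ?thesis
      by (simp add: algebra_simps)
  qed
  show ?thesis
  proof (cases "y \<le> x")
    case True
    then show ?thesis
      using main[of y x] assms by simp
  next
    case False
    \<comment> \<open>For \<open>x < y\<close> the roles are exchanged: the right-hand side is
      symmetric, and since \<open>q - 1\<close> is at most \<open>1\<close>, the left-hand side
      grows when the larger variable carries the coefficient \<open>1\<close>.\<close>
    then have "(2 - q) * x\<^sup>2 \<le> (2 - q) * y\<^sup>2"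
      using assms by (intro mult_left_mono power_mono) auto
    then have "x\<^sup>2 + (q - 1) * y\<^sup>2 \<le> y\<^sup>2 + (q - 1) * x\<^sup>2"
      by (simp add: algebra_simps)
    then have "(x\<^sup>2 + (q - 1) * y\<^sup>2) powr (q / 2) \<le> (y\<^sup>2 + (q - 1) * x\<^sup>2) powr (q / 2)"
      using q by (intro powr_mono2) auto
    then show ?thesis
      using main[of x y] assms False by (simp add: add.commute)
  qed
qed

section \<open>Optimal weights on the simplex\<close>

text \<open>The weights come from the first-order condition at a maximiser \<open>l\<close> of the concave function
  \<open>\<Sum>k<N. sqrt (d + (\<Sum>j<m. l j * b j k))\<close> on the simplex; \<open>d > 0\<close> keeps it differentiable.\<close>

lemma simplex_stationary_weights:
  fixes b :: "nat \<Rightarrow> nat \<Rightarrow> real"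
  assumes b: "\<And>i k. 0 \<le> b i k" and m: "0 < m" and d: "0 < d"
  obtains l where "\<And>j. j < m \<Longrightarrow> 0 \<le> l j" "(\<Sum>j<m. l j) = 1"
    "\<And>i. i < m \<Longrightarrow> (\<Sum>k<N. b i k / sqrt (d + (\<Sum>j<m. l j * b j k)))
        \<le> (\<Sum>k<N. sqrt (d + (\<Sum>j<m. l j * b j k)))"
proof -
  define K where "K = (PiE UNIV (\<lambda>j. if j < m then {0..1::real} else {0})) \<inter> {l. (\<Sum>j<m. l j) = 1}"
  define G where "G l = (\<Sum>k<N. sqrt (d + (\<Sum>j<m. l j * b j k)))" for l :: "nat \<Rightarrow> real"
  have cont: "continuous_on S (\<lambda>l :: nat \<Rightarrow> real. l j)" for S j
    by (rule continuous_on_subset[OF continuous_on_product_coordinates]) simp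
  \<comment> \<open>Tychonoff's theorem on the full product over \<open>nat\<close>: the coordinates
    from \<open>m\<close> on are frozen at \<open>0\<close>.\<close>
  have "compact (PiE UNIV (\<lambda>j. if j < m then {0..1::real} else {0}))"
    using compactin_PiE[of "\<lambda>_. euclidean" UNIV "\<lambda>j. if j < m then {0..1::real} else {0}"]
    by (simp add: euclidean_product_topology)
  moreover have "closed {l :: nat \<Rightarrow> real. (\<Sum>j<m. l j) = 1}"
    by (intro closed_Collect_eq continuous_on_sum continuous_on_const cont)
  ultimately have "compact K"
    unfolding K_def by (rule compact_Int_closed)
  moreover have "(\<lambda>j. if j = 0 then 1 else 0) \<in> K"
    using m by (auto simp: K_def)
  moreover have "continuous_on K G"
    unfolding G_def by (intro continuous_on_sum continuous_on_real_sqrt continuous_on_add continuous_on_const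
      continuous_on_mult_right cont)
  ultimately obtain l where l: "l \<in> K" and max: "\<And>l'. l' \<in> K \<Longrightarrow> G l' \<le> G l"
    using continuous_attains_sup[of K G] by blast
  have nn: "0 \<le> l j" for j
    using l by (auto simp: K_def PiE_iff dest: spec[of _ j] split: if_splits)
  have le1: "l j \<le> 1" for j
    using l by (auto simp: K_def PiE_iff dest: spec[of _ j] split: if_splits)
  have zero: "l j = 0" if "\<not> j < m" for j
    using l that by (auto simp: K_def PiE_iff dest: spec[of _ j] split: if_splits)
  have sum1: "(\<Sum>j<m. l j) = 1"
    using l by (simp add: K_def)
  define s where "s k = d + (\<Sum>j<m. l j * b j k)" for k
  have s: "s k > 0" for k
    using d nn b by (auto simp: s_def intro!: add_pos_nonneg sum_nonneg)
  have "(\<Sum>k<N. b i k / sqrt (s k)) \<le> (\<Sum>k<N. sqrt (s k))" if i: "i < m" for i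
  proof -
    \<comment> \<open>\<open>g\<close> is the objective along the segment from \<open>l\<close> to
      the \<open>i\<close>-th vertex of the simplex, and \<open>e\<close> is the velocity of
      \<open>s\<close> along it.\<close>
    define e where "e k = b i k - (\<Sum>j<m. l j * b j k)" for k
    define g where "g t = (\<Sum>k<N. sqrt (s k + t * e k))" for t
    have "((\<lambda>t. sqrt (s k + t * e k)) has_real_derivative e k * (inverse (sqrt (s k)) / 2)) (at 0 within {0..})"
      for k
    proof -
      have "((\<lambda>t. s k + t * e k) has_real_derivative e k) (at 0 within {0..})"
        by (auto intro!: derivative_eq_intros)
      moreover have "(sqrt has_real_derivative inverse (sqrt (s k)) / 2) (at (s k + 0 * e k))"
        using DERIV_real_sqrt[OF s[of k]] by simp
      ultimately have "((\<lambda>t. sqrt (s k + t * e k)) has_real_derivative inverse (sqrt (s k)) / 2 * e k) (at 0 within {0..})"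
        by (intro DERIV_chain2[where f = sqrt])
      then show ?thesis
        by (simp add: mult.commute)
    qed
    then have "(g has_real_derivative (\<Sum>k<N. e k * (inverse (sqrt (s k)) / 2))) (at 0 within {0..})"
      unfolding g_def by (intro DERIV_sum)
    moreover have "g t \<le> g 0" if t: "0 \<le> t" "t \<le> 1" for t
    proof -
      define l' where "l' j = (1 - t) * l j + t * of_bool (j = i)" for j
      have sum': "(\<Sum>j<m. l' j * c j) = (1 - t) * (\<Sum>j<m. l j * c j) + t * c i" for c :: "nat \<Rightarrow> real"
      proof -
        have "(\<Sum>j<m. l' j * c j) = (\<Sum>j<m. (1 - t) * (l j * c j)) + (\<Sum>j<m. if j = i then t * c j else 0)"
          unfolding sum.distrib[symmetric] by (rule sum.cong) (auto simp: l'_def algebra_simps)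
        then show ?thesis
          using i by (simp add: sum_distrib_left)
      qed
      have "l' \<in> K"
      proof -
        have "0 \<le> l' j" for j
          using t nn by (simp add: l'_def)
        moreover have "l' j \<le> 1" for j
          using t le1[of j] nn[of j] mult_left_mono[OF le1[of j], of "1 - t"] by (cases "j = i") (simp_all add: l'_def)
        moreover have "l' j = 0" if "\<not> j < m" for j
          using that i by (auto simp: l'_def zero)
        moreover have "(\<Sum>j<m. l' j) = 1"
          using sum'[of "\<lambda>_. 1"] sum1 by simp
        ultimately show ?thesis
          by (auto simp: K_def)
      qed
      then have "G l' \<le> G l"
        by (rule max)
      moreover have "G l = g 0"
        by (simp add: G_def g_def s_def)
      moreover have "G l' = g t"
        unfolding G_def g_def sum' s_def e_def by (simp add: algebra_simps)
      ultimately show ?thesis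
        by simp
    qed
    \<comment> \<open>At a maximiser the one-sided derivative cannot be positive. The cap at
      \<open>1\<close> in \<open>h\<close> keeps the test point on the segment.\<close>
    ultimately have le0: "(\<Sum>k<N. e k * (inverse (sqrt (s k)) / 2)) \<le> 0"
    proof -
      assume der: "(g has_real_derivative (\<Sum>k<N. e k * (inverse (sqrt (s k)) / 2))) (at 0 within {0..})"
        and le: "\<And>t. 0 \<le> t \<Longrightarrow> t \<le> 1 \<Longrightarrow> g t \<le> g 0"
      show ?thesis
      proof (rule ccontr)
        assume "\<not> ?thesis"
        then obtain \<delta> where \<delta>: "\<delta> > 0" "\<And>h. 0 < h \<Longrightarrow> h < \<delta> \<Longrightarrow> g 0 < g h"
          using has_real_derivative_pos_inc_right[OF der] by auto
        define h where "h = min (\<delta> / 2) 1"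
        have "0 < h" "h < \<delta>" "h \<le> 1"
          using \<delta>(1) by (auto simp: h_def)
        then show False
          using \<delta>(2)[of h] le[of h] by simp
      qed
    qed
    \<comment> \<open>Replacing \<open>s k\<close> by \<open>s k - d\<close> only lowers the
      subtracted sum, and then \<open>e k\<close> is the difference of the numerators.\<close>
    have "(\<Sum>k<N. b i k / sqrt (s k)) - (\<Sum>k<N. sqrt (s k))
        \<le> (\<Sum>k<N. b i k / sqrt (s k)) - (\<Sum>k<N. (s k - d) / sqrt (s k))"
      using s d by (intro diff_left_mono sum_mono) (simp add: divide_le_eq less_imp_le)
    also have "\<dots> = (\<Sum>k<N. e k / sqrt (s k))"
      unfolding sum_subtractf[symmetric]
      by (rule sum.cong) (simp_all add: s_def e_def diff_divide_distrib)
    also have "\<dots> = 2 * (\<Sum>k<N. e k * (inverse (sqrt (s k)) / 2))"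
      by (simp add: sum_distrib_left inverse_eq_divide)
    finally show ?thesis
      using le0 by simp
  qed
  then show ?thesis
    using that[of l] nn sum1 by (simp add: s_def)
qed

section \<open>Averages over signs\<close>

text \<open>An additive isometric bijection carries the law over from an inner product space. This
  serves the real and the complex alternative of \<open>real_or_complex\<close> alike.\<close>

lemma parallelogram_transport:
  fixes f :: "'c::real_inner \<Rightarrow> 'k::real_normed_field"
    and a b :: 'k
  assumes "bij f" and add: "\<forall>x y. f (x + y) = f x + f y" and norm: "\<forall>x. norm (f x) = norm x"
  shows "(norm (a + b))\<^sup>2 + (norm (a - b))\<^sup>2 = 2 * (norm a)\<^sup>2 + 2 * (norm b)\<^sup>2"
proof -
  obtain x y where xy: "a = f x" "b = f y"
    using \<open>bij f\<close> by (metis bij_pointE)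
  have "f (x - y) + f y = f x"
    using add by (metis diff_add_cancel)
  then have diff: "f (x - y) = f x - f y"
    by (simp add: eq_diff_eq)
  have "(norm (x + y))\<^sup>2 + (norm (x - y))\<^sup>2 = 2 * (norm x)\<^sup>2 + 2 * (norm y)\<^sup>2"
    by (simp add: power2_norm_eq_inner inner_simps inner_commute)
  then show ?thesis
    using add norm unfolding xy by (metis diff)
qed

lemma parallelogram_law:
  fixes a b :: "'k::real_or_complex"
  shows "(norm (a + b))\<^sup>2 + (norm (a - b))\<^sup>2 = 2 * (norm a)\<^sup>2 + 2 * (norm b)\<^sup>2"
  using real_or_complex[where 'a = 'k] by (elim disjE exE conjE) (rule parallelogram_transport; assumption)+

text \<open>By the parallelogram law the squares of \<open>norm (a + b)\<close> and
  \<open>norm (a - b)\<close> have the same sum as those of \<open>norm a + norm b\<close> and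
  \<open>norm a - norm b\<close>, but lie no further apart; \<open>powr_spread\<close> then reduces
  the claim to \<open>two_point_real\<close>.\<close>

lemma two_point_norm:
  fixes a b :: "'k::real_or_complex"
  assumes q: "1 < q" "q \<le> 2"
  shows "2 * ((norm a)\<^sup>2 + (q - 1) * (norm b)\<^sup>2) powr (q / 2)
    \<le> norm (a + b) powr q + norm (a - b) powr q"
proof -
  have sq: "\<bar>z\<bar> powr q = (z\<^sup>2) powr (q / 2)" for z :: real
  proof -
    have "(z\<^sup>2) powr (q / 2) = (\<bar>z\<bar> powr 2) powr (q / 2)"
      by simp
    also have "\<dots> = \<bar>z\<bar> powr q"
      by (simp only: powr_powr) simp
    finally show ?thesis ..
  qed
  have par: "(norm (a + b))\<^sup>2 + (norm (a - b))\<^sup>2 = (norm a + norm b)\<^sup>2 + (norm a - norm b)\<^sup>2"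
    using parallelogram_law[of a b] by (simp add: power2_eq_square algebra_simps)
  have "\<bar>norm a - norm b\<bar> \<le> norm (a + b)"
    using norm_triangle_ineq3[of a "- b"] by simp
  then have "(norm a - norm b)\<^sup>2 \<le> (norm (a + b))\<^sup>2"
    by (metis abs_le_square_iff abs_norm_cancel)
  moreover have "(norm (a + b))\<^sup>2 \<le> (norm a + norm b)\<^sup>2"
    by (intro power_mono norm_triangle_ineq) simp
  ultimately have "((norm a + norm b)\<^sup>2) powr (q / 2) + ((norm a - norm b)\<^sup>2) powr (q / 2)
      \<le> ((norm (a + b))\<^sup>2) powr (q / 2) + ((norm (a - b))\<^sup>2) powr (q / 2)"
    using q par by (intro powr_spread) auto
  moreover have "2 * ((norm a)\<^sup>2 + (q - 1) * (norm b)\<^sup>2) powr (q / 2)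
      \<le> (norm a + norm b) powr q + \<bar>norm a - norm b\<bar> powr q"
    using q by (intro two_point_real) auto
  ultimately show ?thesis
    using sq[of "norm a + norm b"] sq[of "norm a - norm b"] sq[of "norm (a + b)"] sq[of "norm (a - b)"]
    by simp
qed

section \<open>Moments of random signed sums\<close>

text \<open>The signs are scalars of the field, so that they act on vectors, and the set is the
  index set of the mean in \<open>has_type\<close>.\<close>

definition signs :: "nat \<Rightarrow> (nat \<Rightarrow> 'k::real_normed_field) set" where
  "signs n = ({..<n} \<rightarrow>\<^sub>E {-1, 1})"

definition sign_average :: "nat \<Rightarrow> ((nat \<Rightarrow> 'k::real_normed_field) \<Rightarrow> real) \<Rightarrow> real" where
  "sign_average n F = (\<Sum>\<epsilon>\<in>signs n. F \<epsilon>) / 2 ^ n"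

lemma norm_sign: "norm (\<epsilon> j) = 1" if "\<epsilon> \<in> signs n" "j < n"
proof -
  have "\<epsilon> j \<in> {-1, 1}"
    using that by (auto simp: signs_def)
  then show ?thesis
    by auto
qed

lemma card_signs: "card (signs n :: (nat \<Rightarrow> 'k::real_normed_field) set) = 2 ^ n"
proof -
  have "card {-1, 1 :: 'k} = 2"
    by simp
  then show ?thesis
    by (simp only: signs_def card_PiE[OF finite_lessThan] prod_constant card_lessThan)
qed

text \<open>The only member of \<open>signs 0\<close> is the extensional function on the empty
  set.\<close>

lemma sign_average_0: "sign_average 0 F = F (\<lambda>_. undefined)"
  by (simp add: sign_average_def signs_def)

text \<open>Averaging over the last sign first turns two-point inequalities into inequalities for
  \<open>n\<close> signs by induction.\<close>

lemma sign_average_Suc: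
  "sign_average (Suc n) F = sign_average n (\<lambda>\<epsilon>. (F (\<epsilon>(n := 1)) + F (\<epsilon>(n := -1))) / 2)"
proof -
  have eq: "signs (Suc n) = (\<lambda>(y, g). g(n := y)) ` ({-1, 1 :: 'a} \<times> signs n)"
    by (simp add: signs_def lessThan_Suc PiE_insert_eq)
  have inj: "inj_on (\<lambda>(y, g). g(n := y)) ({-1, 1 :: 'a} \<times> signs n)"
    unfolding signs_def using inj_combinator[of n "{..<n}" "\<lambda>_. {-1, 1 :: 'a}"] by simp
  have "(\<Sum>\<epsilon>\<in>signs (Suc n). F \<epsilon>) = (\<Sum>(y, g)\<in>{-1, 1} \<times> signs n. F (g(n := y)))"
    unfolding eq by (subst sum.reindex[OF inj]) (simp add: case_prod_unfold)
  also have "\<dots> = (\<Sum>g\<in>signs n. F (g(n := 1)) + F (g(n := -1)))"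
    by (subst sum.cartesian_product[symmetric]) (simp add: sum.distrib add.commute)
  finally show ?thesis
    by (simp add: sign_average_def sum_divide_distrib)
qed

lemma sign_average_mono:
  "(\<And>\<epsilon>. \<epsilon> \<in> signs n \<Longrightarrow> F \<epsilon> \<le> G \<epsilon>) \<Longrightarrow> sign_average n F \<le> sign_average n G"
  by (auto simp: sign_average_def intro!: divide_right_mono sum_mono)

lemma sign_average_add: "sign_average n (\<lambda>\<epsilon>. F \<epsilon> + G \<epsilon>) = sign_average n F + sign_average n G"
  by (simp add: sign_average_def sum.distrib add_divide_distrib)

lemma sign_average_diff: "sign_average n (\<lambda>\<epsilon>. F \<epsilon> - G \<epsilon>) = sign_average n F - sign_average n G"
  by (simp add: sign_average_def sum_subtractf diff_divide_distrib)

lemma sign_average_cmult: "sign_average n (\<lambda>\<epsilon>. c * F \<epsilon>) = c * sign_average n F"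
  by (simp add: sign_average_def sum_distrib_left)

lemma sign_average_const: "sign_average n (\<lambda>_ :: nat \<Rightarrow> 'k::real_normed_field. c) = c"
  by (simp add: sign_average_def card_signs)

lemma sign_average_sum:
  "sign_average n (\<lambda>\<epsilon>. \<Sum>i\<in>I. F i \<epsilon>) = (\<Sum>i\<in>I. sign_average n (F i))"
  by (simp add: sign_average_def sum_divide_distrib) (rule sum.swap)

text \<open>The variance of \<open>F\<close> is nonnegative.\<close>

lemma sign_average_le_sqrt: "sign_average n F \<le> sqrt (sign_average n (\<lambda>\<epsilon>. (F \<epsilon>)\<^sup>2))"
proof -
  have "0 \<le> sign_average n (\<lambda>\<epsilon>. (F \<epsilon> - sign_average n F)\<^sup>2)"
    by (simp add: sign_average_def sum_nonneg)
  also have "(\<lambda>\<epsilon>. (F \<epsilon> - sign_average n F)\<^sup>2)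
      = (\<lambda>\<epsilon>. (F \<epsilon>)\<^sup>2 - (2 * sign_average n F) * F \<epsilon> + (sign_average n F)\<^sup>2)"
    by (simp add: power2_eq_square algebra_simps)
  also have "sign_average n \<dots> = sign_average n (\<lambda>\<epsilon>. (F \<epsilon>)\<^sup>2) - (sign_average n F)\<^sup>2"
    unfolding sign_average_add sign_average_diff sign_average_cmult sign_average_const
    by (simp add: power2_eq_square)
  finally show ?thesis
    by (intro real_le_rsqrt) simp
qed

lemma sign_sum_upd:
  fixes a :: "nat \<Rightarrow> 'k::real_normed_field"
  shows "(\<Sum>j<Suc n. (\<epsilon>(n := c)) j * a j) = (\<Sum>j<n. \<epsilon> j * a j) + c * a n"
  by simp

text \<open>Orthogonality of the signs: at each induction step the parallelogram law cancels the
  mixed terms.\<close>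

lemma sign_average_sq:
  fixes a :: "nat \<Rightarrow> 'k::real_or_complex"
  shows "sign_average n (\<lambda>\<epsilon>. (norm (\<Sum>j<n. \<epsilon> j * a j))\<^sup>2) = (\<Sum>j<n. (norm (a j))\<^sup>2)"
proof (induction n)
  case (Suc n)
  have split: "((norm (s + 1 * a n))\<^sup>2 + (norm (s + -1 * a n))\<^sup>2) / 2 = (norm s)\<^sup>2 + (norm (a n))\<^sup>2" for s
    using parallelogram_law[of s "a n"] by simp
  show ?case
    unfolding sign_average_Suc sign_sum_upd split sign_average_add sign_average_const Suc by simp
qed (simp add: sign_average_0)

section \<open>Fourth moments and Khinchine's inequality\<close>

text \<open>The parallelogram law fixes the sum of the squares \<open>u\<close> and
  \<open>v\<close>, and their difference is at most \<open>4 * (x * y)\<close>; conclude by \<open>2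
  * (u\<^sup>2 + v\<^sup>2) = (u + v)\<^sup>2 + (u - v)\<^sup>2\<close>.\<close>

lemma fourth_power_two_point:
  fixes a b :: "'k::real_or_complex"
  shows "(norm (a + b) ^ 4 + norm (a - b) ^ 4) / 2
    \<le> norm a ^ 4 + 6 * (norm b)\<^sup>2 * (norm a)\<^sup>2 + norm b ^ 4"
proof -
  define x y u v where "x = norm a" "y = norm b" "u = (norm (a + b))\<^sup>2" "v = (norm (a - b))\<^sup>2"
  have uv: "u + v = 2 * x\<^sup>2 + 2 * y\<^sup>2"
    unfolding x_y_u_v_def by (rule parallelogram_law)
  have "u \<le> (x + y)\<^sup>2" "v \<le> (x + y)\<^sup>2"
    unfolding x_y_u_v_def by (intro power_mono norm_triangle_ineq norm_triangle_ineq4, simp)+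
  then have "\<bar>u - v\<bar> \<le> 4 * (x * y)"
    using uv by (simp add: power2_eq_square algebra_simps abs_le_iff)
  then have "(u - v)\<^sup>2 \<le> (4 * (x * y))\<^sup>2"
    by (metis abs_le_square_iff abs_of_nonneg abs_ge_zero order_trans)
  moreover have "(u + v)\<^sup>2 = (2 * x\<^sup>2 + 2 * y\<^sup>2)\<^sup>2"
    using uv by simp
  ultimately have "2 * (u\<^sup>2 + v\<^sup>2) \<le> (2 * x\<^sup>2 + 2 * y\<^sup>2)\<^sup>2 + (4 * (x * y))\<^sup>2"
    by (simp add: power2_eq_square algebra_simps)
  also have "\<dots> = 4 * (x ^ 4 + 6 * y\<^sup>2 * x\<^sup>2 + y ^ 4)"
    by (simp add: power2_eq_square power4_eq_xxxx algebra_simps)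
  finally have "(u\<^sup>2 + v\<^sup>2) / 2 \<le> x ^ 4 + 6 * y\<^sup>2 * x\<^sup>2 + y ^ 4"
    by simp
  then show ?thesis
    by (simp add: x_y_u_v_def flip: power_mult)
qed

text \<open>If the earlier squares sum to \<open>v\<close>, a new square \<open>b\<close> adds at
  most \<open>6 * b * v + b\<^sup>2\<close>, which fits into
  \<open>3 * (v + b)\<^sup>2 - 3 * v\<^sup>2\<close>.\<close>

lemma sign_average_fourth:
  fixes a :: "nat \<Rightarrow> 'k::real_or_complex"
  shows "sign_average n (\<lambda>\<epsilon>. norm (\<Sum>j<n. \<epsilon> j * a j) ^ 4) \<le> 3 * (\<Sum>j<n. (norm (a j))\<^sup>2)\<^sup>2"
proof (induction n)
  case (Suc n)
  let ?S = "\<lambda>\<epsilon>. norm (\<Sum>j<n. \<epsilon> j * a j)" and ?v = "\<Sum>j<n. (norm (a j))\<^sup>2" and ?b = "(norm (a n))\<^sup>2"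
  have "sign_average (Suc n) (\<lambda>\<epsilon>. norm (\<Sum>j<Suc n. \<epsilon> j * a j) ^ 4)
      \<le> sign_average n (\<lambda>\<epsilon>. ?S \<epsilon> ^ 4 + 6 * ?b * (?S \<epsilon>)\<^sup>2 + norm (a n) ^ 4)"
    unfolding sign_average_Suc sign_sum_upd
    by (rule sign_average_mono) (use fourth_power_two_point[of _ "a n"] in simp)
  also have "\<dots> = sign_average n (\<lambda>\<epsilon>. ?S \<epsilon> ^ 4) + 6 * ?b * ?v + ?b\<^sup>2"
    unfolding sign_average_add sign_average_cmult sign_average_const sign_average_sq by simp
  also have "\<dots> \<le> 3 * ?v\<^sup>2 + 6 * ?b * ?v + 3 * ?b\<^sup>2"
    using Suc zero_le_power2[of ?b] by linarith
  also have "\<dots> = 3 * (\<Sum>j<Suc n. (norm (a j))\<^sup>2)\<^sup>2"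
    by (simp add: power2_eq_square algebra_simps)
  finally show ?case .
qed (simp add: sign_average_0)

text \<open>Integrates the pointwise bound \<open>16 s\<^sup>3 t \<ge> 12 s\<^sup>2 t\<^sup>2 - t\<^sup>4\<close>, that is
  \<open>t (t - 2 s)\<^sup>2 (t + 4 s) \<ge> 0\<close>.\<close>

lemma Khinchine_L1:
  fixes a :: "nat \<Rightarrow> 'k::real_or_complex"
  shows "sqrt (\<Sum>j<n. (norm (a j))\<^sup>2) \<le> 2 * sign_average n (\<lambda>\<epsilon>. norm (\<Sum>j<n. \<epsilon> j * a j))"
proof -
  define s where "s = sqrt (\<Sum>j<n. (norm (a j))\<^sup>2)"
  let ?S = "\<lambda>\<epsilon>. norm (\<Sum>j<n. \<epsilon> j * a j)"
  have s2: "(\<Sum>j<n. (norm (a j))\<^sup>2) = s\<^sup>2" and s0: "s \<ge> 0"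
    by (simp_all add: s_def sum_nonneg)
  have "0 \<le> sign_average n ?S"
    by (simp add: sign_average_def sum_nonneg)
  show ?thesis
  proof (cases "s = 0")
    case False
    then have s: "s > 0"
      using s0 by simp
    have "12 * s\<^sup>2 * t\<^sup>2 - t ^ 4 \<le> 16 * s ^ 3 * t" if "t \<ge> 0" for t
    proof -
      have "0 \<le> t * (t - 2 * s)\<^sup>2 * (t + 4 * s)"
        using that s by simp
      then show ?thesis
        by (simp add: power2_eq_square power3_eq_cube power4_eq_xxxx algebra_simps)
    qed
    then have "sign_average n (\<lambda>\<epsilon>. 12 * s\<^sup>2 * (?S \<epsilon>)\<^sup>2 - ?S \<epsilon> ^ 4) \<le> sign_average n (\<lambda>\<epsilon>. 16 * s ^ 3 * ?S \<epsilon>)"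
      by (intro sign_average_mono) simp
    \<comment> \<open>The second moment is exactly \<open>s\<^sup>2\<close> and the fourth at most
      \<open>3 * s ^ 4\<close>, which leaves \<open>12 - 3 = 9\<close>; the constant
      \<open>16 / 9\<close> is rounded up to \<open>2\<close> below.\<close>
    then have "12 * s\<^sup>2 * s\<^sup>2 - 3 * (s\<^sup>2)\<^sup>2 \<le> 16 * s ^ 3 * sign_average n ?S"
      unfolding sign_average_diff sign_average_cmult sign_average_sq s2
      using sign_average_fourth[of n a] by (simp add: s2)
    then have "s ^ 3 * (9 * s) \<le> s ^ 3 * (16 * sign_average n ?S)"
      by (simp add: power2_eq_square power3_eq_cube)
    then have "9 * s \<le> 16 * sign_average n ?S"
      using s by simp
    then have "s \<le> 2 * sign_average n ?S"
      using s \<open>0 \<le> sign_average n ?S\<close> by linarith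
    then show ?thesis
      by (simp add: s_def)
  qed (use \<open>0 \<le> sign_average n ?S\<close> in \<open>simp flip: s_def\<close>)
qed

section \<open>Normed spaces and their duals\<close>

context normed_space
begin

lemma zero_mem: "0 \<in> vecs E"
  using subspace_0[OF subspace] .

lemma smul_mem: "x \<in> vecs E \<Longrightarrow> smul E c x \<in> vecs E"
  using subspace_scale[OF subspace] .

lemma diff_mem: "x \<in> vecs E \<Longrightarrow> y \<in> vecs E \<Longrightarrow> x - y \<in> vecs E"
  using subspace_diff[OF subspace] .

lemma add_mem: "x \<in> vecs E \<Longrightarrow> y \<in> vecs E \<Longrightarrow> x + y \<in> vecs E"
  using subspace_add[OF subspace] .

lemma norm_zero_vec: "vnorm E 0 = 0"
  using norm_eq_0[OF zero_mem] by simp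

lemma in_mball_vtopology: "y \<in> mball x r \<longleftrightarrow> x \<in> vecs E \<and> y \<in> vecs E \<and> vnorm E (y - x) < r"
  unfolding in_mball commute[of x y] by (auto simp: vdist_def)

lemma openin_vtopology:
  "openin (vtopology E) U \<longleftrightarrow>
     U \<subseteq> vecs E \<and> (\<forall>x\<in>U. \<exists>r>0. \<forall>y\<in>vecs E. vnorm E (y - x) < r \<longrightarrow> y \<in> U)"
proof -
  have ball: "mball x r \<subseteq> U \<longleftrightarrow> (\<forall>y\<in>vecs E. vnorm E (y - x) < r \<longrightarrow> y \<in> U)" if "x \<in> vecs E" for x r
    unfolding subset_iff in_mball_vtopology using that by blast
  show ?thesis
    unfolding vtopology_def openin_mtopology
  proof (rule conj_cong[OF refl])
    assume "U \<subseteq> vecs E"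
    then have "(\<exists>r>0. mball x r \<subseteq> U) \<longleftrightarrow> (\<exists>r>0. \<forall>y\<in>vecs E. vnorm E (y - x) < r \<longrightarrow> y \<in> U)" if "x \<in> U" for x
      using ball[of x] that by (simp add: subset_iff)
    then show "(\<forall>x. x \<in> U \<longrightarrow> (\<exists>r>0. mball x r \<subseteq> U)) \<longleftrightarrow>
        (\<forall>x\<in>U. \<exists>r>0. \<forall>y\<in>vecs E. vnorm E (y - x) < r \<longrightarrow> y \<in> U)"
      by (simp add: Ball_def cong: imp_cong)
  qed
qed

lemma topspace_vtopology: "topspace (vtopology E) = vecs E"
  by (simp add: vtopology_def)

lemma linear_form_zero: "linear_form E f \<Longrightarrow> f 0 = 0"
  using zero_mem unfolding linear_form_def by (metis add_cancel_right_right)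

lemma linear_form_diff:
  "linear_form E f \<Longrightarrow> x \<in> vecs E \<Longrightarrow> y \<in> vecs E \<Longrightarrow> f (x - y) = f x - f y"
  using diff_mem[of x y] unfolding linear_form_def by (metis add_diff_cancel diff_add_cancel)

text \<open>The factor \<open>2\<close> places the scaled vector at norm \<open>r / 2\<close>,
  strictly inside the ball of radius \<open>r\<close>.\<close>

lemma scaled_into_ball:
  assumes "x \<in> vecs E" "x \<noteq> 0" "r > 0"
  defines "c \<equiv> of_real (r / (2 * vnorm E x))"
  shows "smul E c x \<in> vecs E" "vnorm E (smul E c x) < r" "norm c = r / (2 * vnorm E x)" "vnorm E x > 0"
proof -
  show pos: "vnorm E x > 0"
    using norm_nonneg[of x] norm_eq_0[of x] assms by auto
  then show c: "norm c = r / (2 * vnorm E x)"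
    using assms unfolding c_def norm_of_real by simp
  show "smul E c x \<in> vecs E" "vnorm E (smul E c x) < r"
    using pos assms(1,3) by (simp_all add: smul_mem norm_smul c)
qed

lemma continuous_linear_form_iff:
  assumes f: "linear_form E f"
  shows "continuous_map (vtopology E) euclidean f \<longleftrightarrow> (\<exists>B. \<forall>x\<in>vecs E. norm (f x) \<le> B * vnorm E x)"
proof
  assume "continuous_map (vtopology E) euclidean f"
  then have "openin (vtopology E) {x \<in> vecs E. f x \<in> ball 0 1}"
    using openin_continuous_map_preimage[of "vtopology E" euclidean f "ball 0 1"]
    by (simp add: topspace_vtopology)
  moreover have "0 \<in> {x \<in> vecs E. f x \<in> ball 0 1}"
    using linear_form_zero[OF f] zero_mem by simp
  ultimately have "\<exists>r>0. \<forall>y\<in>vecs E. vnorm E (y - 0) < r \<longrightarrow> y \<in> {x \<in> vecs E. f x \<in> ball 0 1}"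
    unfolding openin_vtopology by blast
  then obtain r where r: "r > 0" "\<And>y. y \<in> vecs E \<Longrightarrow> vnorm E y < r \<Longrightarrow> norm (f y) < 1"
    by auto
  have "norm (f x) \<le> (2 / r) * vnorm E x" if x: "x \<in> vecs E" for x
  proof (cases "x = 0")
    case False
    note s = scaled_into_ball[OF x False r(1)]
    have "norm (f (smul E (of_real (r / (2 * vnorm E x))) x)) < 1"
      using s by (intro r) auto
    moreover have "f (smul E (of_real (r / (2 * vnorm E x))) x) = of_real (r / (2 * vnorm E x)) * f x"
      using f x by (simp add: linear_form_def)
    ultimately have "r / (2 * vnorm E x) * norm (f x) < 1"
      by (simp only: norm_mult s(3))
    then show ?thesis
      using s(4) r(1) by (simp add: field_simps)
  qed (use linear_form_zero[OF f] in \<open>simp add: norm_zero_vec\<close>)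
  then show "\<exists>B. \<forall>x\<in>vecs E. norm (f x) \<le> B * vnorm E x"
    by blast
next
  assume "\<exists>B. \<forall>x\<in>vecs E. norm (f x) \<le> B * vnorm E x"
  then obtain B where B: "\<And>x. x \<in> vecs E \<Longrightarrow> norm (f x) \<le> B * vnorm E x"
    by blast
  \<comment> \<open>A positive constant, since it is the divisor in the radius
    \<open>e / C\<close>.\<close>
  define C where "C = max B 1"
  have C: "norm (f x) \<le> C * vnorm E x" "C > 0" if "x \<in> vecs E" for x
    using B[OF that] norm_nonneg[OF that] mult_right_mono[of B C "vnorm E x"] by (auto simp: C_def)
  have "openin (vtopology E) {x \<in> vecs E. f x \<in> U}" if "open U" for U
    unfolding openin_vtopology
  proof safe
    fix x assume x: "x \<in> vecs E" "f x \<in> U"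
    then obtain e where e: "e > 0" "\<And>z. dist z (f x) < e \<Longrightarrow> z \<in> U"
      using \<open>open U\<close> unfolding open_dist by blast
    have "f y \<in> U" if "y \<in> vecs E" "vnorm E (y - x) < e / C" for y
    proof -
      have "norm (f y - f x) \<le> C * vnorm E (y - x)"
        using C(1)[OF diff_mem, of y x] linear_form_diff[OF f, of y x] that x by simp
      also have "\<dots> < e"
        using that C(2)[OF x(1)] by (simp add: field_simps)
      finally show ?thesis
        using e by (simp add: dist_norm)
    qed
    then show "\<exists>r>0. \<forall>y\<in>vecs E. vnorm E (y - x) < r \<longrightarrow> y \<in> {x \<in> vecs E. f x \<in> U}"
      using e C(2)[OF x(1)] by (intro exI[of _ "e / C"]) auto
  qed
  then show "continuous_map (vtopology E) euclidean f"
    by (simp add: continuous_map_def topspace_vtopology)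
qed

section \<open>The dual norm\<close>

text \<open>Trades the topological condition in \<open>dual\<close> for boundedness, the form in
  which membership is checked from here on.\<close>

lemma mem_dual_iff:
  "f \<in> vecs (dual E) \<longleftrightarrow> linear_form E f \<and> (\<exists>B. \<forall>x\<in>vecs E. norm (f x) \<le> B * vnorm E x)"
  by (simp add: dual_def continuous_linear_form_iff cong: conj_cong)

lemma dual_norm_le:
  assumes "\<And>x. x \<in> vecs E \<Longrightarrow> vnorm E x \<le> 1 \<Longrightarrow> norm (f x) \<le> B"
  shows "vnorm (dual E) f \<le> B"
  unfolding dual_def using assms zero_mem norm_zero_vec by (auto intro!: cSUP_least)

text \<open>A real supremum is an upper bound only over a bounded set; boundedness of
  \<open>f\<close> provides this.\<close>

lemma dual_norm_upper:
  assumes f: "f \<in> vecs (dual E)" and x: "x \<in> vecs E" "vnorm E x \<le> 1"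
  shows "norm (f x) \<le> vnorm (dual E) f"
proof -
  obtain B where B: "\<And>x. x \<in> vecs E \<Longrightarrow> norm (f x) \<le> B * vnorm E x"
    using f mem_dual_iff by blast
  have "norm (f y) \<le> \<bar>B\<bar>" if "y \<in> vecs E" "vnorm E y \<le> 1" for y
  proof -
    have "B * vnorm E y \<le> \<bar>B\<bar> * 1"
      using norm_nonneg that by (intro mult_mono) auto
    then show ?thesis
      using B[OF that(1)] by simp
  qed
  then have "bdd_above ((\<lambda>x. norm (f x)) ` {x \<in> vecs E. vnorm E x \<le> 1})"
    by (auto intro!: bdd_aboveI[where M = "\<bar>B\<bar>"])
  then show ?thesis
    using x unfolding dual_def by (auto intro!: cSUP_upper)
qed

lemma dual_norm_nonneg: "f \<in> vecs (dual E) \<Longrightarrow> 0 \<le> vnorm (dual E) f"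
  by (rule order_trans[OF norm_ge_zero dual_norm_upper[of f 0]]) (simp_all add: zero_mem norm_zero_vec)

lemma dual_bound:
  assumes f: "f \<in> vecs (dual E)" and x: "x \<in> vecs E"
  shows "norm (f x) \<le> vnorm (dual E) f * vnorm E x"
proof (cases "x = 0")
  case True
  then show ?thesis
    using f linear_form_zero by (auto simp: mem_dual_iff norm_zero_vec)
next
  case False
  \<comment> \<open>Radius \<open>2\<close> makes the scaling factor \<open>1 / vnorm E x\<close>,
    so the scaled vector has norm \<open>1\<close>.\<close>
  note s = scaled_into_ball[OF x False, of 2, simplified]
  have lin: "linear_form E f"
    using f mem_dual_iff by blast
  have "vnorm E (smul E (of_real (1 / vnorm E x)) x) \<le> 1"
    using s(3,4) x by (simp only: norm_smul) simp
  then have "norm (f (smul E (of_real (1 / vnorm E x)) x)) \<le> vnorm (dual E) f"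
    using f x by (intro dual_norm_upper smul_mem)
  then show ?thesis
    using lin x s(3,4) by (simp add: linear_form_def norm_mult norm_divide field_simps)
qed

lemma dual_norm_le':
  assumes f: "0 \<le> B" "\<And>x. x \<in> vecs E \<Longrightarrow> norm (f x) \<le> B * vnorm E x"
  shows "vnorm (dual E) f \<le> B"
proof (rule dual_norm_le)
  fix x assume "x \<in> vecs E" "vnorm E x \<le> 1"
  then show "norm (f x) \<le> B"
    using f(2)[of x] mult_left_mono[of "vnorm E x" 1 B] f(1) by simp
qed

lemma dual_add_mem:
  assumes "f \<in> vecs (dual E)" "g \<in> vecs (dual E)"
  shows "f + g \<in> vecs (dual E)"
proof -
  have "norm ((f + g) x) \<le> (vnorm (dual E) f + vnorm (dual E) g) * vnorm E x" if "x \<in> vecs E" for x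
    using norm_triangle_ineq[of "f x" "g x"] dual_bound[OF assms(1) that] dual_bound[OF assms(2) that]
    by (simp add: algebra_simps)
  moreover have "linear_form E (f + g)"
    using assms by (simp add: mem_dual_iff linear_form_def algebra_simps)
  ultimately show ?thesis
    by (auto simp: mem_dual_iff)
qed

lemma dual_smul: "smul (dual E) c f = (\<lambda>x. c * f x)"
  by (simp add: dual_def)

lemma dual_smul_mem:
  assumes "f \<in> vecs (dual E)"
  shows "smul (dual E) c f \<in> vecs (dual E)"
proof -
  have "norm (c * f x) \<le> (norm c * vnorm (dual E) f) * vnorm E x" if "x \<in> vecs E" for x
    using mult_left_mono[OF dual_bound[OF assms that], of "norm c"] by (simp add: norm_mult mult.assoc)
  moreover have "linear_form E (\<lambda>x. c * f x)"
    using assms by (simp add: mem_dual_iff linear_form_def algebra_simps)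
  ultimately show ?thesis
    by (auto simp: mem_dual_iff dual_smul)
qed

lemma dual_norm_smul:
  assumes "f \<in> vecs (dual E)"
  shows "vnorm (dual E) (smul (dual E) c f) \<le> norm c * vnorm (dual E) f"
proof (rule dual_norm_le')
  show "norm (smul (dual E) c f x) \<le> norm c * vnorm (dual E) f * vnorm E x" if "x \<in> vecs E" for x
    using mult_left_mono[OF dual_bound[OF assms that], of "norm c"]
    by (simp add: norm_mult mult.assoc dual_smul)
qed (simp add: dual_norm_nonneg assms)

lemma dual_zero_mem: "0 \<in> vecs (dual E)"
  by (auto simp: mem_dual_iff linear_form_def intro!: exI[of _ 0])

lemma dual_sum_mem:
  "(\<And>i. i \<in> I \<Longrightarrow> f i \<in> vecs (dual E)) \<Longrightarrow> (\<Sum>i\<in>I. f i) \<in> vecs (dual E)"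
  by (induction I rule: infinite_finite_induct) (auto intro: dual_zero_mem dual_add_mem)

section \<open>Weak norms and bounded bilinear forms\<close>

text \<open>Every functional in the dual ball gives at most the strong \<open>p\<close>-norm of the
  family, so the supremum is over a bounded set.\<close>

lemma weak_norm_upper:
  assumes p: "0 < p" and x: "\<And>j. j < m \<Longrightarrow> x j \<in> vecs E"
    and \<phi>: "\<phi> \<in> vecs (dual E)" "vnorm (dual E) \<phi> \<le> 1"
  shows "(\<Sum>j<m. norm (\<phi> (x j)) powr p) powr (1 / p) \<le> weak_norm p E m x"
proof -
  have "norm (\<psi> (x j)) \<le> vnorm E (x j)"
    if "\<psi> \<in> vecs (dual E)" "vnorm (dual E) \<psi> \<le> 1" "j < m" for \<psi> j
    using dual_bound[OF that(1) x[OF that(3)]] mult_right_mono[OF that(2) norm_nonneg[OF x[OF that(3)]]]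
    by simp
  then have "(\<Sum>j<m. norm (\<psi> (x j)) powr p) powr (1 / p) \<le> (\<Sum>j<m. vnorm E (x j) powr p) powr (1 / p)"
    if "\<psi> \<in> vecs (dual E)" "vnorm (dual E) \<psi> \<le> 1" for \<psi>
    using p that by (intro powr_mono2 sum_mono) (auto simp: sum_nonneg)
  then have "bdd_above ((\<lambda>\<psi>. (\<Sum>j<m. norm (\<psi> (x j)) powr p) powr (1 / p)) `
      {\<psi> \<in> vecs (dual E). vnorm (dual E) \<psi> \<le> 1})"
    by (auto intro!: bdd_aboveI)
  then show ?thesis
    unfolding weak_norm_def using \<phi> by (intro cSUP_upper) auto
qed

lemma weak_norm_nonneg:
  assumes "0 < p" "\<And>j. j < m \<Longrightarrow> x j \<in> vecs E"
  shows "0 \<le> weak_norm p E m x"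
proof -
  have "vnorm (dual E) 0 \<le> 1"
    by (intro dual_norm_le) simp
  then show ?thesis
    using weak_norm_upper[of p m x 0] assms dual_zero_mem powr_ge_zero order_trans by blast
qed

end

text \<open>Continuity at the origin gives a product neighbourhood on which the form stays below
  \<open>1\<close>. Rescaling the arguments into it, to norms \<open>r / 2\<close> and
  \<open>s / 2\<close>, yields the constant \<open>2 / r * (2 / s)\<close>.\<close>

lemma bounded_bilinear_form:
  assumes E: "normed_space E" and F: "normed_space F" and A: "A \<in> continuous_bilinear_forms E F"
  obtains B where "0 \<le> B" "\<And>x y. x \<in> vecs E \<Longrightarrow> y \<in> vecs F \<Longrightarrow> norm (A x y) \<le> B * vnorm E x * vnorm F y"
proof -
  interpret E: normed_space E by fact
  interpret F: normed_space F by fact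
  have lin: "linear_form F (A x)" "linear_form E (\<lambda>x. A x y)" for x y
    using A by (auto simp: continuous_bilinear_forms_def)
  have "continuous_map (prod_topology (vtopology E) (vtopology F)) euclidean (\<lambda>(x, y). A x y)"
    using A by (simp add: continuous_bilinear_forms_def)
  then have "openin (prod_topology (vtopology E) (vtopology F))
      {z \<in> vecs E \<times> vecs F. (case z of (x, y) \<Rightarrow> A x y) \<in> ball 0 1}"
    using openin_continuous_map_preimage[of "prod_topology (vtopology E) (vtopology F)" euclidean
        "\<lambda>(x, y). A x y" "ball 0 1"]
    by (simp add: E.topspace_vtopology F.topspace_vtopology)
  moreover have "(0, 0) \<in> {z \<in> vecs E \<times> vecs F. (case z of (x, y) \<Rightarrow> A x y) \<in> ball 0 1}"
    using E.zero_mem F.zero_mem F.linear_form_zero[OF lin(1)] by simp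
  ultimately obtain U V where UV: "openin (vtopology E) U" "openin (vtopology F) V" "0 \<in> U" "0 \<in> V"
      "U \<times> V \<subseteq> {z \<in> vecs E \<times> vecs F. (case z of (x, y) \<Rightarrow> A x y) \<in> ball 0 1}"
    unfolding openin_prod_topology_alt by meson
  obtain r where r: "r > 0" "\<And>x. x \<in> vecs E \<Longrightarrow> vnorm E x < r \<Longrightarrow> x \<in> U"
    using UV(1,3) unfolding E.openin_vtopology by (metis diff_zero)
  obtain s where s: "s > 0" "\<And>y. y \<in> vecs F \<Longrightarrow> vnorm F y < s \<Longrightarrow> y \<in> V"
    using UV(2,4) unfolding F.openin_vtopology by (metis diff_zero)
  have "norm (A x y) \<le> (2 / r * (2 / s)) * vnorm E x * vnorm F y"
    if x: "x \<in> vecs E" and y: "y \<in> vecs F" for x y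
  proof (cases "x = 0 \<or> y = 0")
    case True
    then show ?thesis
      using E.linear_form_zero[OF lin(2)] F.linear_form_zero[OF lin(1)]
      by (auto simp: E.norm_zero_vec F.norm_zero_vec)
  next
    case False
    define c d where "c = r / (2 * vnorm E x)" and "d = s / (2 * vnorm F y)"
    note sx = E.scaled_into_ball[OF x _ r(1), folded c_def] and sy = F.scaled_into_ball[OF y _ s(1), folded d_def]
    have pos: "vnorm E x > 0" "vnorm F y > 0" "c > 0" "d > 0"
      using False sx(4) sy(4) r s by (auto simp: c_def d_def)
    have "(smul E (of_real c) x, smul F (of_real d) y) \<in> U \<times> V"
      using False sx sy r s by auto
    then have "norm (A (smul E (of_real c) x) (smul F (of_real d) y)) < 1"
      using UV(5) by (auto simp: dist_norm)
    moreover have "A (smul E (of_real c) x) (smul F (of_real d) y) = of_real c * (of_real d * A x y)"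
      using lin(1)[of x] lin(2)[of "smul F (of_real d) y"] x y by (simp add: linear_form_def)
    ultimately have "c * d * norm (A x y) < 1"
      using pos by (simp add: norm_mult mult.assoc)
    then show ?thesis
      using pos r s by (simp add: c_def d_def field_simps)
  qed
  then show ?thesis
    using that[of "2 / r * (2 / s)"] r s by simp
qed

section \<open>Type 2 of dual spaces\<close>

context normed_space
begin

text \<open>The lower two-point estimate in \<open>E\<close> dualises to an upper one. Vectors of
  the unit ball, tested by \<open>f + g\<close> and \<open>f - g\<close>, are rescaled and
  recombined into a sum and a difference on which \<open>f\<close> and \<open>g\<close> act
  separately.\<close>

lemma dual_two_point:
  assumes c: "c > 0"
    and convex: "\<And>a b. a \<in> vecs E \<Longrightarrow> b \<in> vecs E \<Longrightarrow>
      (vnorm E a)\<^sup>2 + c * (vnorm E b)\<^sup>2 \<le> ((vnorm E (a + b))\<^sup>2 + (vnorm E (a - b))\<^sup>2) / 2"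
    and f: "f \<in> vecs (dual E)" and g: "g \<in> vecs (dual E)"
  shows "(vnorm (dual E) (f + g))\<^sup>2 + (vnorm (dual E) (f - g))\<^sup>2
    \<le> 2 * ((vnorm (dual E) f)\<^sup>2 + (vnorm (dual E) g)\<^sup>2 / c)"
proof -
  define M where "M = 2 * ((vnorm (dual E) f)\<^sup>2 + (vnorm (dual E) g)\<^sup>2 / c)"
  have M: "M \<ge> 0"
    using c by (simp add: M_def)
  have diff_mem_dual: "f - g \<in> vecs (dual E)"
  proof -
    have "f - g = f + smul (dual E) (-1) g"
      by (simp add: dual_smul fun_eq_iff)
    then show ?thesis
      by (simp only: dual_add_mem[OF f dual_smul_mem[OF g]])
  qed
  have lin: "linear_form E f" "linear_form E g"
    using f g by (auto simp: mem_dual_iff)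
  have pointwise: "(norm ((f + g) x))\<^sup>2 + (norm ((f - g) y))\<^sup>2 \<le> M"
    if x: "x \<in> vecs E" "vnorm E x \<le> 1" and y: "y \<in> vecs E" "vnorm E y \<le> 1" for x y
  proof -
    define u v where "u = (f + g) x" and "v = (f - g) y"
    define S where "S = (norm u)\<^sup>2 + (norm v)\<^sup>2"
    \<comment> \<open>The scaling makes \<open>f + g\<close> take the value
      \<open>(norm u)\<^sup>2\<close> at \<open>x'\<close>, while \<open>x'\<close> has norm at most
      \<open>norm u\<close>; likewise \<open>y'\<close> with \<open>f - g\<close> and
      \<open>v\<close>. For \<open>u = 0\<close> the division gives \<open>0\<close>, hence
      \<open>x' = 0\<close>.\<close>
    define x' y' where "x' = smul E (of_real ((norm u)\<^sup>2) / u) x" and "y' = smul E (of_real ((norm v)\<^sup>2) / v) y"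
    have mem: "x' \<in> vecs E" "y' \<in> vecs E"
      using x y by (simp_all add: x'_def y'_def smul_mem)
    have scale: "norm (of_real ((norm z)\<^sup>2) / z) = norm z" "of_real ((norm z)\<^sup>2) / z * z = of_real ((norm z)\<^sup>2)"
      for z :: 'k
    proof -
      show "norm (of_real ((norm z)\<^sup>2) / z) = norm z"
        unfolding norm_divide norm_of_real by (simp add: power2_eq_square)
      show "of_real ((norm z)\<^sup>2) / z * z = of_real ((norm z)\<^sup>2)"
        by (cases "z = 0") simp_all
    qed
    have norms: "vnorm E x' \<le> norm u" "vnorm E y' \<le> norm v"
      using x y mult_left_mono[OF x(2), of "norm u"] mult_left_mono[OF y(2), of "norm v"]
      by (simp_all only: x'_def y'_def norm_smul scale) simp_all
    \<comment> \<open>The hypothesis is used at \<open>x' + y'\<close> and \<open>x' - y'\<close>,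
      whose own sum and difference are twice \<open>x'\<close> and \<open>y'\<close>.\<close>
    have "(vnorm E (x' + y'))\<^sup>2 + c * (vnorm E (x' - y'))\<^sup>2
        \<le> ((vnorm E (x' + x'))\<^sup>2 + (vnorm E (y' + y'))\<^sup>2) / 2"
      using convex[OF add_mem[OF mem] diff_mem[OF mem]] by (simp add: algebra_simps)
    also have "\<dots> \<le> ((2 * norm u)\<^sup>2 + (2 * norm v)\<^sup>2) / 2"
      using norm_triangle[OF mem(1) mem(1)] norm_triangle[OF mem(2) mem(2)] norms
      by (intro divide_right_mono add_mono power_mono norm_nonneg add_mem mem) auto
    also have "\<dots> = 2 * S"
      by (simp add: S_def power2_eq_square)
    finally have sum_le: "(vnorm E (x' + y'))\<^sup>2 + c * (vnorm E (x' - y'))\<^sup>2 \<le> 2 * S" .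
    define F G \<alpha> \<beta> where "F = vnorm (dual E) f" and "G = vnorm (dual E) g"
      and "\<alpha> = vnorm E (x' + y')" and "\<beta> = vnorm E (x' - y')"
    have "f (x' + y') + g (x' - y') = (f x' + g x') + (f y' - g y')"
      using lin mem linear_form_diff[of g x' y'] by (simp add: linear_form_def)
    also have "\<dots> = of_real S"
    proof -
      have "f x' + g x' = of_real ((norm u)\<^sup>2) / u * u"
        using lin x(1) unfolding x'_def linear_form_def by (simp add: u_def ring_distribs add_divide_distrib)
      moreover have "f y' - g y' = of_real ((norm v)\<^sup>2) / v * v"
        using lin y(1) unfolding y'_def linear_form_def by (simp add: v_def ring_distribs diff_divide_distrib)
      ultimately show ?thesis
        by (simp only: scale S_def of_real_add)
    qed
    finally have "\<bar>S\<bar> = norm (f (x' + y') + g (x' - y'))"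
      by (simp only: norm_of_real)
    also have "\<dots> \<le> norm (f (x' + y')) + norm (g (x' - y'))"
      by (rule norm_triangle_ineq)
    also have "\<dots> \<le> F * \<alpha> + G * \<beta>"
      unfolding F_def G_def \<alpha>_def \<beta>_def using mem f g by (intro add_mono dual_bound add_mem diff_mem)
    finally have "S\<^sup>2 \<le> (F * \<alpha> + G * \<beta>)\<^sup>2"
      by (metis abs_le_square_iff abs_ge_self order_trans)
    \<comment> \<open>Lagrange's identity for Cauchy-Schwarz with weights \<open>1\<close> and
      \<open>c\<close>.\<close>
    also have "\<dots> = (F\<^sup>2 + G\<^sup>2 / c) * (\<alpha>\<^sup>2 + c * \<beta>\<^sup>2) - (c * F * \<beta> - G * \<alpha>)\<^sup>2 / c"
      using c by (simp add: field_simps power2_eq_square)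
    also have "\<dots> \<le> (F\<^sup>2 + G\<^sup>2 / c) * (\<alpha>\<^sup>2 + c * \<beta>\<^sup>2)"
      using c by simp
    also have "\<dots> \<le> (F\<^sup>2 + G\<^sup>2 / c) * (2 * S)"
      using c sum_le unfolding \<alpha>_def \<beta>_def by (intro mult_left_mono) auto
    finally have "S * S \<le> M * S"
      by (simp add: M_def F_def G_def power2_eq_square algebra_simps)
    moreover have "S \<ge> 0"
      by (simp add: S_def)
    ultimately have "S \<le> M"
      using M by (cases "S = 0") auto
    then show ?thesis
      by (simp add: S_def u_def v_def)
  qed
  \<comment> \<open>In the pointwise bound \<open>x\<close> and \<open>y\<close> vary independently,
    so the suprema over them are taken one after the other.\<close>
  have bound1: "(norm ((f - g) y))\<^sup>2 + (vnorm (dual E) (f + g))\<^sup>2 \<le> M"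
    if y: "y \<in> vecs E" "vnorm E y \<le> 1" for y
  proof -
    have "vnorm (dual E) (f + g) \<le> sqrt (M - (norm ((f - g) y))\<^sup>2)"
    proof (rule dual_norm_le)
      fix x assume "x \<in> vecs E" "vnorm E x \<le> 1"
      from pointwise[OF this y] show "norm ((f + g) x) \<le> sqrt (M - (norm ((f - g) y))\<^sup>2)"
        by (intro real_le_rsqrt) linarith
    qed
    then have "(vnorm (dual E) (f + g))\<^sup>2 \<le> (sqrt (M - (norm ((f - g) y))\<^sup>2))\<^sup>2"
      using dual_norm_nonneg[OF dual_add_mem[OF f g]] by (intro power_mono)
    moreover have "(norm ((f - g) y))\<^sup>2 \<le> M"
      using pointwise[OF zero_mem _ y] norm_zero_vec
        zero_le_power2[of "norm ((f + g) 0)"] by linarith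
    ultimately show ?thesis
      by simp
  qed
  have "vnorm (dual E) (f - g) \<le> sqrt (M - (vnorm (dual E) (f + g))\<^sup>2)"
  proof (rule dual_norm_le)
    fix y assume "y \<in> vecs E" "vnorm E y \<le> 1"
    from bound1[OF this] show "norm ((f - g) y) \<le> sqrt (M - (vnorm (dual E) (f + g))\<^sup>2)"
      by (intro real_le_rsqrt) linarith
  qed
  then have "(vnorm (dual E) (f - g))\<^sup>2 \<le> (sqrt (M - (vnorm (dual E) (f + g))\<^sup>2))\<^sup>2"
    using dual_norm_nonneg[OF diff_mem_dual] by (intro power_mono)
  moreover have "(vnorm (dual E) (f + g))\<^sup>2 \<le> M"
    using bound1[OF zero_mem] norm_zero_vec zero_le_power2[of "norm ((f - g) 0)"] by linarith
  ultimately show ?thesis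
    by (simp add: M_def)
qed

text \<open>Induction on \<open>n\<close>: averaged over its sign, a new functional raises the mean
  square norm by at most its squared norm over \<open>c\<close>. Hence the type constant
  \<open>sqrt (1 / c)\<close>.\<close>

lemma dual_type_2:
  assumes c: "c > 0"
    and convex: "\<And>a b. a \<in> vecs E \<Longrightarrow> b \<in> vecs E \<Longrightarrow>
      (vnorm E a)\<^sup>2 + c * (vnorm E b)\<^sup>2 \<le> ((vnorm E (a + b))\<^sup>2 + (vnorm E (a - b))\<^sup>2) / 2"
  shows "has_type 2 (dual E)"
proof -
  define T where "T n f \<epsilon> = (\<Sum>j<n. smul (dual E) (\<epsilon> j) (f j))" for n :: nat and f and \<epsilon> :: "nat \<Rightarrow> 'k"
  have avg: "sign_average n (\<lambda>\<epsilon>. (vnorm (dual E) (T n f \<epsilon>))\<^sup>2) \<le> (\<Sum>j<n. (vnorm (dual E) (f j))\<^sup>2) / c"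
    if "\<forall>j<n. f j \<in> vecs (dual E)" for n f
    using that
  proof (induction n)
    case 0
    have "vnorm (dual E) 0 = 0"
      using dual_norm_le'[of 0 0] dual_norm_nonneg[OF dual_zero_mem] by simp
    then show ?case
      unfolding T_def sign_average_0 by (simp flip: zero_fun_def)
  next
    case (Suc n)
    have step: "((vnorm (dual E) (T (Suc n) f (\<epsilon>(n := 1))))\<^sup>2 + (vnorm (dual E) (T (Suc n) f (\<epsilon>(n := -1))))\<^sup>2) / 2
        \<le> (vnorm (dual E) (T n f \<epsilon>))\<^sup>2 + (vnorm (dual E) (f n))\<^sup>2 / c" for \<epsilon>
    proof -
      have mem: "T n f \<epsilon> \<in> vecs (dual E)" "f n \<in> vecs (dual E)"
        unfolding T_def using Suc.prems by (auto intro!: dual_sum_mem dual_smul_mem)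
      have T_Suc: "T (Suc n) f (\<epsilon>(n := 1)) = T n f \<epsilon> + f n" "T (Suc n) f (\<epsilon>(n := -1)) = T n f \<epsilon> - f n"
        by (simp_all add: T_def dual_smul fun_eq_iff)
      have "(vnorm (dual E) (T (Suc n) f (\<epsilon>(n := 1))))\<^sup>2 + (vnorm (dual E) (T (Suc n) f (\<epsilon>(n := -1))))\<^sup>2
          \<le> 2 * ((vnorm (dual E) (T n f \<epsilon>))\<^sup>2 + (vnorm (dual E) (f n))\<^sup>2 / c)"
        unfolding T_Suc by (rule dual_two_point[OF c convex mem])
      then show ?thesis
        by (simp only: pos_divide_le_eq[of 2] zero_less_numeral mult.commute[of _ 2])
    qed
    have "sign_average (Suc n) (\<lambda>\<epsilon>. (vnorm (dual E) (T (Suc n) f \<epsilon>))\<^sup>2)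
        \<le> sign_average n (\<lambda>\<epsilon>. (vnorm (dual E) (T n f \<epsilon>))\<^sup>2 + (vnorm (dual E) (f n))\<^sup>2 / c)"
      unfolding sign_average_Suc by (intro sign_average_mono step)
    also have "\<dots> \<le> (\<Sum>j<n. (vnorm (dual E) (f j))\<^sup>2) / c + (vnorm (dual E) (f n))\<^sup>2 / c"
      unfolding sign_average_add sign_average_const using Suc by simp
    finally show ?case
      by (simp add: add_divide_distrib)
  qed
  show ?thesis
    unfolding has_type_def
  proof (intro exI[of _ "sqrt (1 / c)"] allI impI)
    fix n :: nat and f assume f: "\<forall>j<n. f j \<in> vecs (dual E)"
    have "(\<Sum>j<n. vnorm (dual E) (f j) powr 2) = (\<Sum>j<n. (vnorm (dual E) (f j))\<^sup>2)"
      using f dual_norm_nonneg by (intro sum.cong) auto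
    then have "sqrt (1 / c) * (\<Sum>j<n. vnorm (dual E) (f j) powr 2) powr (1 / 2)
        = sqrt ((\<Sum>j<n. (vnorm (dual E) (f j))\<^sup>2) / c)"
      by (simp add: powr_half_sqrt sum_nonneg real_sqrt_divide)
    then show "sqrt ((\<Sum>\<epsilon>\<in>{..<n} \<rightarrow>\<^sub>E {-1, 1}. (vnorm (dual E) (\<Sum>j<n. smul (dual E) (\<epsilon> j) (f j)))\<^sup>2) / 2 ^ n)
        \<le> sqrt (1 / c) * (\<Sum>j<n. vnorm (dual E) (f j) powr 2) powr (1 / 2)"
      using avg[OF f] by (simp add: sign_average_def signs_def T_def)
  qed
qed

end

section \<open>The sequence spaces\<close>

lemma mem_lp: "x \<in> vecs (lp p) \<longleftrightarrow> summable (\<lambda>n. norm (x n) powr p)"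
  by (simp add: lp_def)

lemma lp_norm_nonneg: "0 \<le> vnorm (lp p) x"
  by (simp add: lp_def)

lemma lp_norm_powr:
  assumes "0 < p" "x \<in> vecs (lp p)"
  shows "vnorm (lp p) x powr p = (\<Sum>n. norm (x n) powr p)"
proof -
  have "(\<Sum>n. norm (x n) powr p) \<ge> 0"
    using assms by (intro suminf_nonneg) (auto simp: mem_lp)
  then show ?thesis
    using assms by (simp add: lp_def powr_powr)
qed

lemma lp_norm_le:
  assumes "0 < p" "x \<in> vecs (lp p)" "0 \<le> B" "(\<Sum>n. norm (x n) powr p) \<le> B powr p"
  shows "vnorm (lp p) x \<le> B"
proof -
  have "vnorm (lp p) x powr p \<le> B powr p"
    using assms by (simp add: lp_norm_powr)
  then show ?thesis
    using powr_less_mono2[OF assms(1,3)] by (meson not_less)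
qed

lemma lp_add_mem:
  assumes p: "1 \<le> p" and x: "x \<in> vecs (lp p)" and y: "y \<in> vecs (lp p)"
  shows "x + y \<in> vecs (lp p)"
proof -
  have bound: "norm ((x + y) n) powr p \<le> 2 powr p * (norm (x n) powr p + norm (y n) powr p)" for n
  proof -
    have "norm ((x + y) n) powr p \<le> (norm (x n) + norm (y n)) powr p"
      using p by (intro powr_mono2) (auto intro: norm_triangle_ineq)
    also have "\<dots> = 2 powr p * (1 / 2 * norm (x n) + 1 / 2 * norm (y n)) powr p"
      by (simp flip: powr_mult)
    also have "\<dots> \<le> 2 powr p * (1 / 2 * norm (x n) powr p + 1 / 2 * norm (y n) powr p)"
      using p by (intro mult_left_mono powr_convex) auto
    also have "\<dots> \<le> 2 powr p * (norm (x n) powr p + norm (y n) powr p)"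
      by (intro mult_left_mono add_mono) auto
    finally show ?thesis .
  qed
  have "summable (\<lambda>n. 2 powr p * (norm (x n) powr p + norm (y n) powr p))"
    using x y by (intro summable_mult summable_add) (auto simp: mem_lp)
  then show ?thesis
    unfolding mem_lp by (rule summable_comparison_test'[of _ 0]) (use bound in auto)
qed

lemma lp_norm_eq_0:
  assumes "0 < p" "x \<in> vecs (lp p)"
  shows "vnorm (lp p) x = 0 \<longleftrightarrow> x = 0"
proof
  assume "vnorm (lp p) x = 0"
  then have "(\<Sum>n. norm (x n) powr p) = 0"
    using lp_norm_powr[OF assms] by simp
  then have "\<forall>n. norm (x n) powr p = 0"
    using assms by (subst (asm) suminf_eq_zero_iff) (auto simp: mem_lp)
  then show "x = 0"
    by (simp add: fun_eq_iff)
qed (simp add: lp_def)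

lemma lp_smul: "smul (lp p) c x = (\<lambda>n. c * x n)"
  by (simp add: lp_def)

lemma lp_norm_smul:
  assumes "0 < p" "x \<in> vecs (lp p)"
  shows "vnorm (lp p) (smul (lp p) c x) = norm c * vnorm (lp p) x"
proof -
  have "(\<Sum>n. norm (c * x n) powr p) = norm c powr p * (\<Sum>n. norm (x n) powr p)"
    using assms by (subst suminf_mult[symmetric]) (auto simp: mem_lp norm_mult powr_mult)
  moreover have "(\<Sum>n. norm (x n) powr p) \<ge> 0"
    using assms by (intro suminf_nonneg) (auto simp: mem_lp)
  ultimately show ?thesis
    using assms by (simp add: lp_def powr_mult powr_powr)
qed

text \<open>Minkowski's inequality. With \<open>S = X + Y\<close>, the vector \<open>x + y\<close>
  is \<open>S\<close> times a convex combination of the normalised \<open>x\<close> and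
  \<open>y\<close>; convexity in each coordinate sums to exactly \<open>S powr p\<close>.\<close>

lemma lp_norm_triangle:
  assumes p: "1 \<le> p" and x: "x \<in> vecs (lp p)" and y: "y \<in> vecs (lp p)"
  shows "vnorm (lp p) (x + y) \<le> vnorm (lp p) x + vnorm (lp p) y"
proof -
  define X Y where "X = vnorm (lp p) x" and "Y = vnorm (lp p) y"
  have nonneg: "X \<ge> 0" "Y \<ge> 0"
    by (simp_all add: X_def Y_def lp_norm_nonneg)
  consider "X = 0" | "Y = 0" | "X > 0" "Y > 0"
    using nonneg by linarith
  then show ?thesis
  proof cases
    case 1
    then have "x = 0"
      using lp_norm_eq_0[of p x] p x by (simp add: X_def)
    then show ?thesis
      by (simp add: lp_norm_nonneg)
  next
    case 2
    then have "y = 0"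
      using lp_norm_eq_0[of p y] p y by (simp add: Y_def)
    then show ?thesis
      by (simp add: lp_norm_nonneg)
  next
    case 3
    define S where "S = X + Y"
    have S: "S > 0"
      using 3 by (simp add: S_def)
    have uv: "X / S + Y / S = 1"
      using S by (simp add: S_def flip: add_divide_distrib)
    have bound: "norm ((x + y) n) powr p \<le> S powr p * (X / S * (norm (x n) powr p / X powr p)
        + Y / S * (norm (y n) powr p / Y powr p))" for n
    proof -
      have "norm ((x + y) n) powr p \<le> (norm (x n) + norm (y n)) powr p"
        using p by (intro powr_mono2) (auto intro: norm_triangle_ineq)
      also have "norm (x n) + norm (y n) = S * (X / S * (norm (x n) / X) + Y / S * (norm (y n) / Y))"
        using 3 S by (simp add: field_simps)
      also have "\<dots> powr p = S powr p * (X / S * (norm (x n) / X) + Y / S * (norm (y n) / Y)) powr p"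
        using 3 S by (intro powr_mult)
      also have "\<dots> \<le> S powr p * (X / S * (norm (x n) / X) powr p + Y / S * (norm (y n) / Y) powr p)"
        using 3 S p uv by (intro mult_left_mono powr_convex) auto
      finally show ?thesis
        using 3 by (simp add: powr_divide)
    qed
    have summable: "summable (\<lambda>n. norm (x n) powr p)" "summable (\<lambda>n. norm (y n) powr p)"
      using x y by (simp_all add: mem_lp)
    then have sums: "(\<lambda>n. norm (x n) powr p) sums (X powr p)" "(\<lambda>n. norm (y n) powr p) sums (Y powr p)"
      unfolding X_def Y_def using p x y by (auto simp: lp_norm_powr summable_sums)
    have "(\<lambda>n. S powr p * (X / S * (norm (x n) powr p / X powr p) + Y / S * (norm (y n) powr p / Y powr p)))
        sums (S powr p * (X / S * (X powr p / X powr p) + Y / S * (Y powr p / Y powr p)))"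
      by (intro sums_mult sums_add sums_divide sums)
    also have "S powr p * (X / S * (X powr p / X powr p) + Y / S * (Y powr p / Y powr p)) = S powr p"
      using 3 uv by simp
    finally have "(\<Sum>n. norm ((x + y) n) powr p) \<le> S powr p"
      using bound lp_add_mem[OF p x y] unfolding mem_lp
      by (intro sums_le[OF _ summable_sums]) auto
    then show ?thesis
      using p S lp_add_mem[OF p x y] by (intro lp_norm_le) (auto simp: S_def X_def Y_def)
  qed
qed

lemma normed_space_lp:
  assumes p: "1 \<le> p"
  shows "normed_space (lp p :: ('k::real_or_complex, nat \<Rightarrow> 'k) nspace)"
proof -
  have vs: "vector_space (smul (lp p :: ('k, nat \<Rightarrow> 'k) nspace))"
    by unfold_locales (auto simp: lp_smul fun_eq_iff algebra_simps)
  then interpret vector_space "smul (lp p :: ('k, nat \<Rightarrow> 'k) nspace)" .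
  have smul: "smul (lp p) c x \<in> vecs (lp p)" if "x \<in> vecs (lp p)" for c and x :: "nat \<Rightarrow> 'k"
    using that by (auto simp: mem_lp lp_smul norm_mult powr_mult)
  have "subspace (vecs (lp p) :: (nat \<Rightarrow> 'k) set)"
    using p by (intro subspaceI smul lp_add_mem) (auto simp: mem_lp)
  then show ?thesis
    using p vs by unfold_locales
      (auto simp: lp_norm_nonneg lp_norm_eq_0 lp_norm_smul lp_norm_triangle normed_space_def)
qed

text \<open>Sums \<open>two_point_norm\<close> over the coordinates. Since \<open>h = q / 2\<close>
  is at most \<open>1\<close>, this calls for a reverse Minkowski inequality for the squared
  coordinates, obtained by bounding the power of each sum below with fixed coefficients.\<close>

lemma lp_uniformly_convex:
  fixes a b :: "nat \<Rightarrow> 'k::real_or_complex"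
  assumes q: "1 < q" "q \<le> 2" and a: "a \<in> vecs (lp q)" and b: "b \<in> vecs (lp q)"
  shows "(vnorm (lp q) a)\<^sup>2 + (q - 1) * (vnorm (lp q) b)\<^sup>2
    \<le> ((vnorm (lp q) (a + b))\<^sup>2 + (vnorm (lp q) (a - b))\<^sup>2) / 2"
proof -
  interpret normed_space "lp q :: ('k, nat \<Rightarrow> 'k) nspace"
    using q by (intro normed_space_lp) simp
  define h where "h = q / 2"
  have h: "0 < h" "h \<le> 1"
    using q by (simp_all add: h_def)
  have sq: "(z\<^sup>2) powr h = z powr q" if "z \<ge> 0" for z :: real
  proof -
    have "(z\<^sup>2) powr h = (z powr 2) powr h"
      using that by simp
    also have "\<dots> = z powr q"
      by (simp only: powr_powr h_def) simp
    finally show ?thesis .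
  qed
  define D where "D = (vnorm (lp q) a)\<^sup>2 + (q - 1) * (vnorm (lp q) b)\<^sup>2"
  define P Q where "P = vnorm (lp q) (a + b)" and "Q = vnorm (lp q) (a - b)"
  have PQ: "P \<ge> 0" "Q \<ge> 0"
    by (simp_all add: P_def Q_def lp_norm_nonneg)
  have "D \<le> (P\<^sup>2 + Q\<^sup>2) / 2"
  proof (cases "D = 0")
    case False
    then have D: "D > 0"
      using q unfolding D_def by (smt (verit) mult_nonneg_nonneg zero_le_power2)
    \<comment> \<open>\<open>u\<close> and \<open>v\<close> are the shares of the two terms in
      \<open>D\<close>. With the factors \<open>u powr (1 - h)\<close> and
      \<open>v powr (1 - h)\<close>, the same for all coordinates, the bound \<open>split\<close> is
      an equality for the totals \<open>u * D\<close> and \<open>v * D\<close>.\<close>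
    define u v where "u = (vnorm (lp q) a)\<^sup>2 / D" and "v = (q - 1) * (vnorm (lp q) b)\<^sup>2 / D"
    have uv: "u \<ge> 0" "v \<ge> 0" "u + v = 1"
      using D q by (simp_all add: u_def v_def D_def flip: add_divide_distrib)
    have rescale: "w powr (1 - h) * z powr h = w * (z / w) powr h" if "w > 0" "z \<ge> 0" for w z :: real
      using that by (simp add: powr_diff powr_divide)
    \<comment> \<open>Concavity at the points \<open>s / u\<close> and \<open>t / v\<close>; shares
      equal to \<open>0\<close> are treated apart.\<close>
    have split: "u powr (1 - h) * s powr h + v powr (1 - h) * t powr h \<le> (s + t) powr h"
      if st: "s \<ge> 0" "t \<ge> 0" for s t :: real
    proof -
      consider "u = 0" "v = 1" | "u = 1" "v = 0" | "u > 0" "v > 0"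
        using uv by fastforce
      then show ?thesis
      proof cases
        case 3
        then show ?thesis
          using powr_concave[of "s / u" "t / v" u v h] st uv h by (simp add: rescale)
      qed (use st h in \<open>auto intro!: powr_mono2\<close>)
    qed
    have bound: "u powr (1 - h) * norm (a n) powr q + v powr (1 - h) * ((q - 1) powr h * norm (b n) powr q)
        \<le> (norm ((a + b) n) powr q + norm ((a - b) n) powr q) / 2" for n
    proof -
      have "u powr (1 - h) * norm (a n) powr q + v powr (1 - h) * ((q - 1) powr h * norm (b n) powr q)
          = u powr (1 - h) * ((norm (a n))\<^sup>2) powr h + v powr (1 - h) * ((q - 1) * (norm (b n))\<^sup>2) powr h"
        using q by (simp add: powr_mult sq)
      also have "\<dots> \<le> ((norm (a n))\<^sup>2 + (q - 1) * (norm (b n))\<^sup>2) powr h"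
        using q by (intro split) auto
      also have "\<dots> \<le> (norm ((a + b) n) powr q + norm ((a - b) n) powr q) / 2"
        using two_point_norm[OF q, of "a n" "b n"] by (simp add: h_def)
      finally show ?thesis .
    qed
    have sums: "(\<lambda>n. norm (x n) powr q) sums (vnorm (lp q) x powr q)" if "x \<in> vecs (lp q)" for x :: "nat \<Rightarrow> 'k"
      using that q summable_sums[of "\<lambda>n. norm (x n) powr q"] by (simp add: lp_norm_powr mem_lp)
    have recombine: "w powr (1 - h) * (w * D) powr h = w * D powr h" if "w \<ge> 0" for w
      using that D by (cases "w = 0") (simp_all add: powr_mult powr_diff)
    have "D powr h = u powr (1 - h) * (u * D) powr h + v powr (1 - h) * (v * D) powr h"
      using uv by (simp add: recombine flip: distrib_right)
    also have "\<dots> = u powr (1 - h) * vnorm (lp q) a powr q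
        + v powr (1 - h) * ((q - 1) powr h * vnorm (lp q) b powr q)"
      using D q by (simp add: u_def v_def powr_mult sq lp_norm_nonneg)
    also have "\<dots> \<le> (P powr q + Q powr q) / 2"
    proof (rule sums_le[OF bound])
      show "(\<lambda>n. u powr (1 - h) * norm (a n) powr q + v powr (1 - h) * ((q - 1) powr h * norm (b n) powr q))
          sums (u powr (1 - h) * vnorm (lp q) a powr q + v powr (1 - h) * ((q - 1) powr h * vnorm (lp q) b powr q))"
        by (intro sums_add sums_mult sums a b)
      show "(\<lambda>n. (norm ((a + b) n) powr q + norm ((a - b) n) powr q) / 2) sums ((P powr q + Q powr q) / 2)"
        unfolding P_def Q_def by (intro sums_divide sums_add sums add_mem diff_mem a b)
    qed
    also have "\<dots> = 1 / 2 * (P\<^sup>2) powr h + 1 / 2 * (Q\<^sup>2) powr h"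
      using PQ by (simp add: sq)
    \<comment> \<open>Concavity again, from the mean of the powers to the power of the mean.\<close>
    also have "\<dots> \<le> (1 / 2 * P\<^sup>2 + 1 / 2 * Q\<^sup>2) powr h"
      using h by (intro powr_concave) auto
    finally have "D powr h \<le> (1 / 2 * P\<^sup>2 + 1 / 2 * Q\<^sup>2) powr h" .
    moreover have "0 \<le> 1 / 2 * P\<^sup>2 + 1 / 2 * Q\<^sup>2"
      by simp
    ultimately have "D \<le> 1 / 2 * P\<^sup>2 + 1 / 2 * Q\<^sup>2"
      using powr_less_mono2[OF h(1)] by (meson not_less)
    then show ?thesis
      by simp
  qed simp
  then show ?thesis
    by (simp add: D_def P_def Q_def)
qed

lemma dual_lp_type_2:
  assumes "1 < q" "q \<le> 2"
  shows "has_type 2 (dual (lp q :: ('k::real_or_complex, nat \<Rightarrow> 'k) nspace))"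
proof -
  interpret normed_space "lp q :: ('k, nat \<Rightarrow> 'k) nspace"
    using assms by (intro normed_space_lp) simp
  show ?thesis
    using assms by (intro dual_type_2[of "q - 1"] lp_uniformly_convex) auto
qed

section \<open>Summing bilinear forms\<close>

text \<open>By homogeneity: a functional of nonzero norm is scaled into the dual ball, and one of
  norm \<open>0\<close> vanishes on every \<open>y j\<close>.\<close>

lemma (in normed_space) sum_functional_le:
  assumes y: "\<And>j. j < m \<Longrightarrow> y j \<in> vecs E"
    and M: "\<And>\<phi>. \<phi> \<in> vecs (dual E) \<Longrightarrow> vnorm (dual E) \<phi> \<le> 1 \<Longrightarrow> (\<Sum>j<m. norm (\<phi> (y j))) \<le> M"
    and f: "f \<in> vecs (dual E)"
  shows "(\<Sum>j<m. norm (f (y j))) \<le> vnorm (dual E) f * M"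
proof (cases "vnorm (dual E) f = 0")
  case True
  then have "norm (f (y j)) \<le> 0" if "j < m" for j
    using dual_bound[OF f y[OF that]] by simp
  then show ?thesis
    using True by simp
next
  case False
  define t where "t = vnorm (dual E) f"
  have t: "t > 0"
    using False dual_norm_nonneg[OF f] by (simp add: t_def)
  define g where "g = smul (dual E) (of_real (1 / t)) f"
  have norm_c: "norm (of_real (1 / t) :: 'k) = 1 / t"
    using t unfolding norm_of_real by simp
  have "vnorm (dual E) g \<le> 1"
    using dual_norm_smul[OF f, of "of_real (1 / t)"] t unfolding g_def norm_c by (simp flip: t_def)
  then have "(\<Sum>j<m. norm (g (y j))) \<le> M"
    unfolding g_def by (intro M dual_smul_mem f)
  moreover have "norm (g (y j)) = norm (f (y j)) / t" for j
    unfolding g_def dual_smul norm_mult norm_c by simp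
  ultimately have "(\<Sum>j<m. norm (f (y j))) / t \<le> M"
    by (simp add: sum_divide_distrib)
  then show ?thesis
    using t by (simp add: t_def[symmetric] divide_le_eq mult.commute)
qed

text \<open>Type \<open>2\<close> controls second moments, whereas sums of absolute values produce
  first moments; \<open>sign_average_le_sqrt\<close> links them.\<close>

lemma (in normed_space) dual_type_2_sign_average:
  assumes "has_type 2 (dual E)"
  obtains T where "0 \<le> T" "\<And>n f. (\<And>j. j < n \<Longrightarrow> f j \<in> vecs (dual E)) \<Longrightarrow>
    sign_average n (\<lambda>\<epsilon>. vnorm (dual E) (\<Sum>j<n. smul (dual E) (\<epsilon> j) (f j)))
      \<le> T * sqrt (\<Sum>j<n. (vnorm (dual E) (f j))\<^sup>2)"
proof -
  obtain C where C: "\<And>n f. \<forall>j<n. f j \<in> vecs (dual E) \<Longrightarrow>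
      sqrt (sign_average n (\<lambda>\<epsilon>. (vnorm (dual E) (\<Sum>j<n. smul (dual E) (\<epsilon> j) (f j)))\<^sup>2))
        \<le> C * (\<Sum>j<n. vnorm (dual E) (f j) powr 2) powr (1 / 2)"
    using assms unfolding has_type_def sign_average_def signs_def by blast
  show ?thesis
  \<comment> \<open>The constant from \<open>has_type\<close> carries no sign condition.\<close>
  proof (rule that[of "max C 0"])
    fix n and f :: "nat \<Rightarrow> 'a \<Rightarrow> 'k" assume f: "\<And>j. j < n \<Longrightarrow> f j \<in> vecs (dual E)"
    have "(\<Sum>j<n. vnorm (dual E) (f j) powr 2) = (\<Sum>j<n. (vnorm (dual E) (f j))\<^sup>2)"
      using f dual_norm_nonneg by (intro sum.cong) auto
    then have sq: "(\<Sum>j<n. vnorm (dual E) (f j) powr 2) powr (1 / 2) = sqrt (\<Sum>j<n. (vnorm (dual E) (f j))\<^sup>2)"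
      by (simp add: powr_half_sqrt sum_nonneg)
    have "sign_average n (\<lambda>\<epsilon>. vnorm (dual E) (\<Sum>j<n. smul (dual E) (\<epsilon> j) (f j)))
        \<le> sqrt (sign_average n (\<lambda>\<epsilon>. (vnorm (dual E) (\<Sum>j<n. smul (dual E) (\<epsilon> j) (f j)))\<^sup>2))"
      by (rule sign_average_le_sqrt)
    also have "\<dots> \<le> C * sqrt (\<Sum>j<n. (vnorm (dual E) (f j))\<^sup>2)"
      using C[of n f] f unfolding sq by blast
    also have "\<dots> \<le> max C 0 * sqrt (\<Sum>j<n. (vnorm (dual E) (f j))\<^sup>2)"
      by (intro mult_right_mono) (auto simp: sum_nonneg)
    finally show "sign_average n (\<lambda>\<epsilon>. vnorm (dual E) (\<Sum>j<n. smul (dual E) (\<epsilon> j) (f j)))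
        \<le> max C 0 * sqrt (\<Sum>j<n. (vnorm (dual E) (f j))\<^sup>2)" .
  qed simp
qed

section \<open>Estimates and basis expansion on \<open>lp 1\<close>\<close>

lemma l1_norm: "vnorm (lp 1) x = (\<Sum>n. norm (x n))" if "x \<in> vecs (lp 1)"
  using lp_norm_powr[of 1 x] that by (simp add: lp_norm_nonneg)

lemma mem_l1: "x \<in> vecs (lp 1) \<longleftrightarrow> summable (\<lambda>n. norm (x n))"
  by (simp add: mem_lp)

text \<open>The functional on \<open>\<ell>\<^sub>1\<close> with coefficients the conjugate phases of the sums, cut off at
  \<open>N\<close>, has norm at most \<open>1\<close> and realises the left-hand side.\<close>

lemma l1_weak_norm_column_sums:
  fixes x :: "nat \<Rightarrow> nat \<Rightarrow> 'k::real_or_complex" and \<theta> :: "nat \<Rightarrow> 'k"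
  assumes x: "\<And>j. j < m \<Longrightarrow> x j \<in> vecs (lp 1)" and \<theta>: "(\<Sum>j<m. (norm (\<theta> j))\<^sup>2) \<le> 1"
  shows "(\<Sum>k<N. norm (\<Sum>j<m. \<theta> j * x j k)) \<le> weak_norm 2 (lp 1) m x"
proof -
  interpret normed_space "lp 1 :: ('k, nat \<Rightarrow> 'k) nspace"
    by (intro normed_space_lp) simp
  define S where "S k = (\<Sum>j<m. \<theta> j * x j k)" for k
  \<comment> \<open>Where \<open>S k = 0\<close>, division gives \<open>b k = 0\<close>, which keeps
    both properties of \<open>b\<close>.\<close>
  define b where "b k = of_real (norm (S k)) / S k" for k
  have b: "norm (b k) \<le> 1" "b k * S k = of_real (norm (S k))" for k
    by (cases "S k = 0"; simp add: b_def norm_divide)+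
  define \<phi> where "\<phi> z = (if z \<in> vecs (lp 1) then \<Sum>k<N. b k * z k else 0)" for z
  have lin: "linear_form (lp 1) \<phi>"
    unfolding linear_form_def
    by (auto simp: \<phi>_def add_mem smul_mem[unfolded lp_smul] lp_smul sum.distrib sum_distrib_left algebra_simps)
  have bound: "norm (\<phi> z) \<le> 1 * vnorm (lp 1) z" if z: "z \<in> vecs (lp 1)" for z
  proof -
    have "norm (\<phi> z) \<le> (\<Sum>k<N. norm (b k * z k))"
      using z by (simp add: \<phi>_def norm_sum)
    also have "\<dots> \<le> (\<Sum>k<N. norm (z k))"
      using b(1) by (intro sum_mono) (simp add: norm_mult mult_left_le_one_le)
    also have "\<dots> \<le> (\<Sum>k. norm (z k))"
      using z by (intro sum_le_suminf) (auto simp: mem_l1)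
    finally show ?thesis
      using z by (simp add: l1_norm)
  qed
  have \<phi>: "\<phi> \<in> vecs (dual (lp 1))" "vnorm (dual (lp 1)) \<phi> \<le> 1"
    using lin bound by (auto simp: mem_dual_iff intro!: dual_norm_le' exI[of _ 1])
  have "of_real (\<Sum>k<N. norm (S k)) = (\<Sum>k<N. b k * S k)"
    by (simp add: b)
  also have "\<dots> = (\<Sum>j<m. \<theta> j * (\<Sum>k<N. b k * x j k))"
    unfolding S_def sum_distrib_left by (subst sum.swap) (simp add: algebra_simps)
  also have "\<dots> = (\<Sum>j<m. \<theta> j * \<phi> (x j))"
    using x by (simp add: \<phi>_def)
  finally have "\<bar>\<Sum>k<N. norm (S k)\<bar> = norm (\<Sum>j<m. \<theta> j * \<phi> (x j))"
    by (metis norm_of_real)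
  also have "\<dots> \<le> (\<Sum>j<m. norm (\<theta> j) * norm (\<phi> (x j)))"
    by (rule sum_norm_le) (simp add: norm_mult)
  also have "\<dots> \<le> sqrt ((\<Sum>j<m. (norm (\<theta> j))\<^sup>2) * (\<Sum>j<m. (norm (\<phi> (x j)))\<^sup>2))"
    by (intro real_le_rsqrt Cauchy_Schwarz_ineq_sum)
  also have "\<dots> \<le> sqrt (1 * (\<Sum>j<m. (norm (\<phi> (x j)))\<^sup>2))"
    using \<theta> by (intro real_sqrt_le_mono mult_right_mono) (auto simp: sum_nonneg)
  also have "\<dots> = (\<Sum>j<m. norm (\<phi> (x j)) powr 2) powr (1 / 2)"
    by (simp add: powr_half_sqrt sum_nonneg)
  also have "\<dots> \<le> weak_norm 2 (lp 1) m x"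
    using x \<phi> by (intro weak_norm_upper) auto
  finally show ?thesis
    by (simp add: S_def)
qed

text \<open>Truncations of \<open>x\<close> converge to it in norm and \<open>A\<close> is bounded:
  the error is at most \<open>B\<close> times the tail of the norm series times
  \<open>vnorm E y\<close>.\<close>

lemma l1_basis_expansion:
  fixes A :: "(nat \<Rightarrow> 'k::real_or_complex) \<Rightarrow> 'b::ab_group_add \<Rightarrow> 'k"
  assumes E: "normed_space E" and A: "A \<in> continuous_bilinear_forms (lp 1) E"
    and x: "x \<in> vecs (lp 1)" and y: "y \<in> vecs E"
  shows "(\<lambda>k. x k * A (\<lambda>n. of_bool (n = k)) y) sums A x y"
proof -
  interpret normed_space "lp 1 :: ('k, nat \<Rightarrow> 'k) nspace"
    by (intro normed_space_lp) simp
  obtain B where B: "0 \<le> B" "\<And>x y. x \<in> vecs (lp 1) \<Longrightarrow> y \<in> vecs E \<Longrightarrow> norm (A x y) \<le> B * vnorm (lp 1) x * vnorm E y"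
    using bounded_bilinear_form[OF normed_space_axioms E A] by blast
  define e :: "nat \<Rightarrow> nat \<Rightarrow> 'k" where "e k n = of_bool (n = k)" for k n
  define x' where "x' N n = (if n < N then x n else 0)" for N n
  have e: "e k \<in> vecs (lp 1)" for k
    unfolding mem_l1 by (rule summable_finite[of "{k}"]) (auto simp: e_def)
  have x': "x' N \<in> vecs (lp 1)" for N
    unfolding mem_l1 by (rule summable_finite[of "{..<N}"]) (auto simp: x'_def)
  have lin: "linear_form (lp 1) (\<lambda>x. A x y)"
    using A by (simp add: continuous_bilinear_forms_def)
  have partial: "A (x' N) y = (\<Sum>k<N. x k * A (e k) y)" for N
  proof (induction N)
    case 0
    have "x' 0 = 0"
      by (simp add: x'_def fun_eq_iff)
    then show ?case
      using linear_form_zero[OF lin] by (simp only: lessThan_0 sum.empty)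
  next
    case (Suc N)
    have "x' (Suc N) = x' N + smul (lp 1) (x N) (e N)"
      by (auto simp: x'_def e_def lp_smul fun_eq_iff less_Suc_eq)
    then have "A (x' (Suc N)) y = A (x' N) y + A (smul (lp 1) (x N) (e N)) y"
      using lin x' smul_mem[OF e] unfolding linear_form_def by metis
    also have "A (smul (lp 1) (x N) (e N)) y = x N * A (e N) y"
      using lin e unfolding linear_form_def by blast
    finally show ?case
      using Suc by simp
  qed
  have tail: "vnorm (lp 1) (x - x' N) = (\<Sum>n. norm (x n)) - (\<Sum>n<N. norm (x n))" for N
  proof -
    have "(\<lambda>n. norm (x n)) sums (\<Sum>n. norm (x n))"
      using x by (simp add: mem_l1 summable_sums)
    moreover have "(\<lambda>n. if n < N then norm (x n) else 0) sums (\<Sum>n<N. norm (x n))"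
      using sums_If_finite[of "\<lambda>n. n < N" "\<lambda>n. norm (x n)"] by (simp add: lessThan_def)
    ultimately have "(\<lambda>n. norm (x n) - (if n < N then norm (x n) else 0)) sums
        ((\<Sum>n. norm (x n)) - (\<Sum>n<N. norm (x n)))"
      by (rule sums_diff)
    moreover have "norm (x n) - (if n < N then norm (x n) else 0) = norm ((x - x' N) n)" for n
      by (simp add: x'_def)
    ultimately show ?thesis
      using diff_mem[OF x x'] by (simp add: l1_norm sums_iff)
  qed
  have error: "norm (A (x' N) y - A x y) \<le> B * ((\<Sum>n. norm (x n)) - (\<Sum>n<N. norm (x n))) * vnorm E y" for N
    using B(2)[OF diff_mem[OF x x'] y] linear_form_diff[OF lin x x'] by (simp add: tail norm_minus_commute)
  have "(\<lambda>N. B * ((\<Sum>n. norm (x n)) - (\<Sum>n<N. norm (x n))) * vnorm E y)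
      \<longlonglongrightarrow> B * ((\<Sum>n. norm (x n)) - (\<Sum>n. norm (x n))) * vnorm E y"
    using x by (intro tendsto_mult tendsto_diff tendsto_const summable_LIMSEQ) (simp add: mem_l1)
  also have "B * ((\<Sum>n. norm (x n)) - (\<Sum>n. norm (x n))) * vnorm E y = 0"
    by simp
  finally have "(\<lambda>N. A (x' N) y - A x y) \<longlonglongrightarrow> 0"
    by (rule Lim_null_comparison[OF always_eventually[OF allI[OF error]]])
  then have "(\<lambda>N. A (x' N) y) \<longlonglongrightarrow> A x y"
    by (simp add: LIM_zero_iff)
  then show ?thesis
    unfolding sums_def partial e_def .
qed

text \<open>The stationary weights are applied to \<open>\<bar>x i k\<bar>\<^sup>2\<close>; Cauchy--Schwarz with weights
  \<open>sqrt (s k)\<close> then separates the \<open>x i k\<close> from the functionals.\<close>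

lemma (in normed_space) sum_matrix_functionals_le:
  fixes x :: "nat \<Rightarrow> nat \<Rightarrow> 'k"
  assumes T: "0 \<le> T" "\<And>n f. (\<And>j. j < n \<Longrightarrow> f j \<in> vecs (dual E)) \<Longrightarrow>
      sign_average n (\<lambda>\<epsilon>. vnorm (dual E) (\<Sum>j<n. smul (dual E) (\<epsilon> j) (f j)))
        \<le> T * sqrt (\<Sum>j<n. (vnorm (dual E) (f j))\<^sup>2)"
    and \<phi>: "\<And>k. \<phi> k \<in> vecs (dual E)" "\<And>k. vnorm (dual E) (\<phi> k) \<le> B"
    and x: "\<And>j. j < m \<Longrightarrow> x j \<in> vecs (lp 1)" and y: "\<And>j. j < m \<Longrightarrow> y j \<in> vecs E"
    and M: "\<And>\<psi>. \<psi> \<in> vecs (dual E) \<Longrightarrow> vnorm (dual E) \<psi> \<le> 1 \<Longrightarrow> (\<Sum>j<m. norm (\<psi> (y j))) \<le> M"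
  shows "(\<Sum>i<m. norm (\<Sum>k<N. x i k * \<phi> k (y i))) \<le> 4 * T * B * (weak_norm 2 (lp 1) m x * M)"
proof (cases "m = 0")
  \<comment> \<open>For \<open>m = 0\<close> the simplex is empty; only nonnegativity of the
    right-hand side is at stake.\<close>
  case True
  have "0 \<le> B"
    using dual_norm_nonneg[OF \<phi>(1)] \<phi>(2) order_trans by blast
  moreover have "0 \<le> M"
    using M[OF dual_zero_mem] dual_norm_le'[of 0 0] by simp
  moreover have "0 \<le> weak_norm 2 (lp 1) m x"
    using normed_space.weak_norm_nonneg[OF normed_space_lp[of 1], of 2 m x] x by simp
  ultimately show ?thesis
    using True T by simp
next
  case False
  define W where "W = weak_norm 2 (lp 1) m x"
  have B: "0 \<le> B"
    using dual_norm_nonneg[OF \<phi>(1)] \<phi>(2) order_trans by blast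
  have M0: "0 \<le> M"
    using M[OF dual_zero_mem] dual_norm_le'[of 0 0] by simp
  \<comment> \<open>\<open>\<delta>\<^sup>2\<close> is the regularisation \<open>d\<close> of the
    weights. It costs \<open>real N * \<delta>\<close> and disappears in the limit at the
    end.\<close>
  have bound: "(\<Sum>i<m. norm (\<Sum>k<N. x i k * \<phi> k (y i))) \<le> 2 * (real N * \<delta> + 2 * W) * (T * B * M)"
    if \<delta>: "\<delta> > 0" for \<delta>
  proof -
    obtain l where l: "\<And>j. j < m \<Longrightarrow> 0 \<le> l j" "(\<Sum>j<m. l j) = 1"
      "\<And>i. i < m \<Longrightarrow> (\<Sum>k<N. (norm (x i k))\<^sup>2 / sqrt (\<delta>\<^sup>2 + (\<Sum>j<m. l j * (norm (x j k))\<^sup>2)))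
        \<le> (\<Sum>k<N. sqrt (\<delta>\<^sup>2 + (\<Sum>j<m. l j * (norm (x j k))\<^sup>2)))"
      using simplex_stationary_weights[of "\<lambda>i k. (norm (x i k))\<^sup>2" m "\<delta>\<^sup>2" N] False \<delta> by auto
    \<comment> \<open>Up to normalisation by \<open>G\<close>, \<open>s\<close> is the probability
      vector \<open>\<mu>\<close> of the overview.\<close>
    define s where "s k = sqrt (\<delta>\<^sup>2 + (\<Sum>j<m. l j * (norm (x j k))\<^sup>2))" for k
    define G where "G = (\<Sum>k<N. s k)"
    have s: "s k > 0" for k
      using \<delta> l(1) by (auto simp: s_def intro!: add_pos_nonneg sum_nonneg)
    have G0: "G \<ge> 0"
      unfolding G_def using s by (simp add: sum_nonneg less_imp_le)
    \<comment> \<open>Khinchine is applied in each column with coefficients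
      \<open>sqrt (l j) * x j k\<close>. Each sign choice then gives multipliers whose squares sum
      to \<open>1\<close>, so the column sums are bounded by \<open>W\<close>.\<close>
    have "G \<le> (\<Sum>k<N. \<delta> + 2 * sign_average m (\<lambda>\<epsilon> :: nat \<Rightarrow> 'k. norm (\<Sum>j<m. \<epsilon> j * (of_real (sqrt (l j)) * x j k))))"
      unfolding G_def
    proof (rule sum_mono)
      fix k
      have "s k \<le> sqrt (\<delta>\<^sup>2) + sqrt (\<Sum>j<m. l j * (norm (x j k))\<^sup>2)"
        unfolding s_def using l(1) by (intro sqrt_add_le_add_sqrt sum_nonneg) auto
      also have "(\<Sum>j<m. l j * (norm (x j k))\<^sup>2) = (\<Sum>j<m. (norm (of_real (sqrt (l j)) * x j k))\<^sup>2)"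
        using l(1) by (intro sum.cong) (auto simp: norm_mult power_mult_distrib)
      also have "sqrt \<dots> \<le> 2 * sign_average m (\<lambda>\<epsilon> :: nat \<Rightarrow> 'k. norm (\<Sum>j<m. \<epsilon> j * (of_real (sqrt (l j)) * x j k)))"
        by (rule Khinchine_L1)
      finally show "s k \<le> \<delta> + 2 * sign_average m (\<lambda>\<epsilon> :: nat \<Rightarrow> 'k. norm (\<Sum>j<m. \<epsilon> j * (of_real (sqrt (l j)) * x j k)))"
        using \<delta> by simp
    qed
    also have "\<dots> = real N * \<delta> + 2 * sign_average m
        (\<lambda>\<epsilon> :: nat \<Rightarrow> 'k. \<Sum>k<N. norm (\<Sum>j<m. \<epsilon> j * (of_real (sqrt (l j)) * x j k)))"
      by (simp add: sum.distrib sign_average_sum sum_distrib_left)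
    also have "\<dots> \<le> real N * \<delta> + 2 * sign_average m (\<lambda>\<epsilon> :: nat \<Rightarrow> 'k. W)"
    proof (intro add_left_mono mult_left_mono sign_average_mono)
      fix \<epsilon> :: "nat \<Rightarrow> 'k" assume \<epsilon>: "\<epsilon> \<in> signs m"
      have "(\<Sum>j<m. (norm (\<epsilon> j * of_real (sqrt (l j))))\<^sup>2) = (\<Sum>j<m. l j)"
        using l(1) norm_sign[OF \<epsilon>] by (intro sum.cong) (auto simp: norm_mult power_mult_distrib)
      then have "(\<Sum>k<N. norm (\<Sum>j<m. (\<epsilon> j * of_real (sqrt (l j))) * x j k)) \<le> W"
        unfolding W_def using x l(2) by (intro l1_weak_norm_column_sums) auto
      then show "(\<Sum>k<N. norm (\<Sum>j<m. \<epsilon> j * (of_real (sqrt (l j)) * x j k))) \<le> W"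
        by (simp add: mult.assoc)
    qed simp
    finally have G_le: "G \<le> real N * \<delta> + 2 * W"
      by (simp add: sign_average_const)
    define f where "f k = smul (dual E) (of_real (sqrt (s k))) (\<phi> k)" for k
    have f: "f k \<in> vecs (dual E)" for k
      unfolding f_def by (intro dual_smul_mem \<phi>)
    have norm_s: "norm (of_real (sqrt (s k)) :: 'k) = sqrt (s k)" for k
      using s[of k] unfolding norm_of_real by simp
    define \<Phi> where "\<Phi> \<epsilon> = (\<Sum>k<N. smul (dual E) (\<epsilon> k) (f k))" for \<epsilon> :: "nat \<Rightarrow> 'k"
    have \<Phi>_apply: "\<Phi> \<epsilon> v = (\<Sum>k<N. \<epsilon> k * f k v)" for \<epsilon> v
      unfolding \<Phi>_def by (induction N) (simp_all add: dual_smul)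
    \<comment> \<open>The first Cauchy-Schwarz factor is controlled by stationarity of
      \<open>l\<close>; Khinchine turns the second into the mean of a random functional at
      \<open>y i\<close>.\<close>
    have row: "norm (\<Sum>k<N. x i k * \<phi> k (y i)) \<le> sqrt G * (2 * sign_average N (\<lambda>\<epsilon>. norm (\<Phi> \<epsilon> (y i))))"
      if i: "i < m" for i
    proof -
      have "norm (\<Sum>k<N. x i k * \<phi> k (y i)) \<le> (\<Sum>k<N. (norm (x i k) / sqrt (s k)) * norm (f k (y i)))"
      proof (rule sum_norm_le)
        fix k
        show "norm (x i k * \<phi> k (y i)) \<le> norm (x i k) / sqrt (s k) * norm (f k (y i))"
          using s[of k] unfolding f_def dual_smul norm_mult norm_s by simp
      qed
      also have "\<dots> \<le> sqrt ((\<Sum>k<N. (norm (x i k) / sqrt (s k))\<^sup>2) * (\<Sum>k<N. (norm (f k (y i)))\<^sup>2))"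
        by (intro real_le_rsqrt Cauchy_Schwarz_ineq_sum)
      also have "(\<Sum>k<N. (norm (x i k) / sqrt (s k))\<^sup>2) = (\<Sum>k<N. (norm (x i k))\<^sup>2 / s k)"
        using s by (simp add: power_divide less_imp_le)
      also have "sqrt (\<dots> * (\<Sum>k<N. (norm (f k (y i)))\<^sup>2)) \<le> sqrt (G * (\<Sum>k<N. (norm (f k (y i)))\<^sup>2))"
        using l(3)[OF i] by (intro real_sqrt_le_mono mult_right_mono) (auto simp: G_def s_def sum_nonneg)
      also have "\<dots> = sqrt G * sqrt (\<Sum>k<N. (norm (f k (y i)))\<^sup>2)"
        by (simp add: real_sqrt_mult)
      also have "\<dots> \<le> sqrt G * (2 * sign_average N (\<lambda>\<epsilon>. norm (\<Phi> \<epsilon> (y i))))"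
        unfolding \<Phi>_apply using G0 by (intro mult_left_mono Khinchine_L1) auto
      finally show ?thesis .
    qed
    have "(\<Sum>i<m. norm (\<Sum>k<N. x i k * \<phi> k (y i)))
        \<le> (\<Sum>i<m. sqrt G * (2 * sign_average N (\<lambda>\<epsilon>. norm (\<Phi> \<epsilon> (y i)))))"
      by (intro sum_mono row) simp
    also have "\<dots> = 2 * sqrt G * sign_average N (\<lambda>\<epsilon>. \<Sum>i<m. norm (\<Phi> \<epsilon> (y i)))"
      by (simp add: sign_average_sum sum_distrib_left algebra_simps)
    \<comment> \<open>Under the average one functional \<open>\<Phi> \<epsilon>\<close> acts on all
      \<open>y i\<close>, so \<open>M\<close> bounds the sum over \<open>i\<close>.\<close>
    also have "\<dots> \<le> 2 * sqrt G * sign_average N (\<lambda>\<epsilon>. M * vnorm (dual E) (\<Phi> \<epsilon>))"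
    proof (intro mult_left_mono sign_average_mono)
      fix \<epsilon> :: "nat \<Rightarrow> 'k"
      have "\<Phi> \<epsilon> \<in> vecs (dual E)"
        unfolding \<Phi>_def by (intro dual_sum_mem dual_smul_mem f)
      then have "(\<Sum>i<m. norm (\<Phi> \<epsilon> (y i))) \<le> vnorm (dual E) (\<Phi> \<epsilon>) * M"
        by (intro sum_functional_le) (simp_all add: y M)
      then show "(\<Sum>i<m. norm (\<Phi> \<epsilon> (y i))) \<le> M * vnorm (dual E) (\<Phi> \<epsilon>)"
        by (simp add: mult.commute)
    qed (use G0 in simp)
    also have "\<dots> = 2 * sqrt G * M * sign_average N (\<lambda>\<epsilon>. vnorm (dual E) (\<Phi> \<epsilon>))"
      by (simp add: sign_average_cmult)
    also have "\<dots> \<le> 2 * sqrt G * M * (T * sqrt (\<Sum>k<N. (vnorm (dual E) (f k))\<^sup>2))"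
      unfolding \<Phi>_def using M0 G0 by (intro mult_left_mono T f) auto
    also have "\<dots> \<le> 2 * sqrt G * M * (T * sqrt (\<Sum>k<N. B\<^sup>2 * s k))"
    proof (intro mult_left_mono real_sqrt_le_mono sum_mono)
      fix k
      have "vnorm (dual E) (f k) \<le> sqrt (s k) * vnorm (dual E) (\<phi> k)"
        using dual_norm_smul[OF \<phi>(1), of "of_real (sqrt (s k))" k] unfolding f_def norm_s .
      also have "\<dots> \<le> sqrt (s k) * B"
        using s[of k] by (intro mult_left_mono \<phi>) auto
      finally have "(vnorm (dual E) (f k))\<^sup>2 \<le> (sqrt (s k) * B)\<^sup>2"
        using dual_norm_nonneg[OF f] by (intro power_mono)
      then show "(vnorm (dual E) (f k))\<^sup>2 \<le> B\<^sup>2 * s k"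
        using s[of k] by (simp add: power_mult_distrib mult.commute)
    qed (use M0 G0 T in auto)
    \<comment> \<open>One \<open>sqrt G\<close> comes from the rows, the other from type
      \<open>2\<close>, since the \<open>s k\<close> sum to \<open>G\<close>.\<close>
    also have "\<dots> = 2 * (sqrt G * sqrt G) * (T * B * M)"
      using B by (simp add: G_def real_sqrt_mult flip: sum_distrib_left)
    also have "\<dots> = 2 * G * (T * B * M)"
      using G0 by simp
    also have "\<dots> \<le> 2 * (real N * \<delta> + 2 * W) * (T * B * M)"
      using G_le T B M0 by (intro mult_right_mono mult_left_mono) auto
    finally show ?thesis .
  qed
  have "((\<lambda>\<delta>. 2 * (real N * \<delta> + 2 * W) * (T * B * M)) \<longlongrightarrow> 2 * (real N * 0 + 2 * W) * (T * B * M)) (at_right 0)"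
    by (intro tendsto_intros)
  then have "(\<Sum>i<m. norm (\<Sum>k<N. x i k * \<phi> k (y i))) \<le> 2 * (real N * 0 + 2 * W) * (T * B * M)"
    by (rule tendsto_lowerbound) (rule eventually_at_rightI[of 0 1], rule bound, simp_all)
  then show ?thesis
    by (simp add: W_def algebra_simps)
qed

lemma l1_form_sum_le:
  fixes A :: "(nat \<Rightarrow> 'k::real_or_complex) \<Rightarrow> 'b::ab_group_add \<Rightarrow> 'k"
  assumes E: "normed_space E" and type: "has_type 2 (dual E)"
    and A: "A \<in> continuous_bilinear_forms (lp 1) E"
  obtains C where "0 < C" "\<And>m x y M. (\<And>j. j < m \<Longrightarrow> x j \<in> vecs (lp 1)) \<Longrightarrow> (\<And>j. j < m \<Longrightarrow> y j \<in> vecs E) \<Longrightarrow>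
    (\<And>\<psi>. \<psi> \<in> vecs (dual E) \<Longrightarrow> vnorm (dual E) \<psi> \<le> 1 \<Longrightarrow> (\<Sum>j<m. norm (\<psi> (y j))) \<le> M) \<Longrightarrow>
    (\<Sum>j<m. norm (A (x j) (y j))) \<le> C * (weak_norm 2 (lp 1) m x * M)"
proof -
  interpret normed_space E by fact
  interpret l1: normed_space "lp 1 :: ('k, nat \<Rightarrow> 'k) nspace"
    by (intro normed_space_lp) simp
  obtain B where B: "0 \<le> B" "\<And>x y. x \<in> vecs (lp 1) \<Longrightarrow> y \<in> vecs E \<Longrightarrow> norm (A x y) \<le> B * vnorm (lp 1) x * vnorm E y"
    using bounded_bilinear_form[OF l1.normed_space_axioms E A] by blast
  obtain T where T: "0 \<le> T" "\<And>n f. (\<And>j. j < n \<Longrightarrow> f j \<in> vecs (dual E)) \<Longrightarrow>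
      sign_average n (\<lambda>\<epsilon>. vnorm (dual E) (\<Sum>j<n. smul (dual E) (\<epsilon> j) (f j)))
        \<le> T * sqrt (\<Sum>j<n. (vnorm (dual E) (f j))\<^sup>2)"
    using dual_type_2_sign_average[OF type] by blast
  define e :: "nat \<Rightarrow> nat \<Rightarrow> 'k" where "e k n = of_bool (n = k)" for k n
  have e: "e k \<in> vecs (lp 1)" for k
    unfolding mem_l1 by (rule summable_finite[of "{k}"]) (auto simp: e_def)
  have norm_e: "vnorm (lp 1) (e k) = 1" for k
  proof -
    have "(\<Sum>n. norm (e k n)) = (\<Sum>n\<in>{k}. norm (e k n))"
      by (rule suminf_finite) (auto simp: e_def)
    then show ?thesis
      by (simp add: l1_norm[OF e]) (simp add: e_def)
  qed
  have lin: "linear_form E (A z)" for z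
    using A by (simp add: continuous_bilinear_forms_def)
  have bound: "norm (A (e k) v) \<le> B * vnorm E v" if "v \<in> vecs E" for k v
    using B(2)[OF e that, of k] by (simp add: norm_e)
  have \<phi>: "A (e k) \<in> vecs (dual E)" "vnorm (dual E) (A (e k)) \<le> B" for k
    using lin bound B(1) by (auto simp: mem_dual_iff intro!: dual_norm_le')
  show ?thesis
  \<comment> \<open>The summand \<open>1\<close> makes the constant strictly positive, as
    \<open>summing_forms\<close> requires.\<close>
  proof (rule that[of "4 * T * B + 1"])
    show "0 < 4 * T * B + 1"
      using T B by (intro add_nonneg_pos) auto
    fix m M and x :: "nat \<Rightarrow> nat \<Rightarrow> 'k" and y
    assume x: "\<And>j. j < m \<Longrightarrow> x j \<in> vecs (lp 1)" and y: "\<And>j. j < m \<Longrightarrow> y j \<in> vecs E"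
      and M: "\<And>\<psi>. \<psi> \<in> vecs (dual E) \<Longrightarrow> vnorm (dual E) \<psi> \<le> 1 \<Longrightarrow> (\<Sum>j<m. norm (\<psi> (y j))) \<le> M"
    have partial: "(\<Sum>i<m. norm (\<Sum>k<N. x i k * A (e k) (y i))) \<le> 4 * T * B * (weak_norm 2 (lp 1) m x * M)" for N
      by (rule sum_matrix_functionals_le[where \<phi> = "\<lambda>k. A (e k)"]) (fact T \<phi> x y M)+
    have "(\<lambda>N. \<Sum>i<m. norm (\<Sum>k<N. x i k * A (e k) (y i))) \<longlonglongrightarrow> (\<Sum>i<m. norm (A (x i) (y i)))"
      using l1_basis_expansion[OF E A] x y unfolding sums_def e_def
      by (intro tendsto_sum tendsto_norm) auto
    then have "(\<Sum>i<m. norm (A (x i) (y i))) \<le> 4 * T * B * (weak_norm 2 (lp 1) m x * M)"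
      by (rule LIMSEQ_le_const2) (use partial in blast)
    moreover have "0 \<le> weak_norm 2 (lp 1) m x"
      using l1.weak_norm_nonneg[of 2 m x] x by simp
    moreover have "0 \<le> M"
      using M[OF dual_zero_mem] dual_norm_le'[of 0 0] by simp
    ultimately show "(\<Sum>j<m. norm (A (x j) (y j))) \<le> (4 * T * B + 1) * (weak_norm 2 (lp 1) m x * M)"
      by (simp add: distrib_right add_increasing2)
  qed
qed

text \<open>The exponent \<open>r\<close> is reached from the exponent \<open>1\<close> by scaling \<open>y j\<close> with
  \<open>\<bar>A (x j) (y j)\<bar> powr (r - 1)\<close> and Hoelder's inequality.\<close>

lemma continuous_form_on_l1_summing:
  fixes E :: "('k::real_or_complex, 'b::ab_group_add) nspace"
  assumes E: "normed_space E" and type: "has_type 2 (dual E)" and r: "1 \<le> r"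
    and A: "A \<in> continuous_bilinear_forms (lp 1) E"
  shows "A \<in> summing_forms r 2 r (lp 1) E"
proof -
  interpret normed_space E by fact
  obtain C where C: "0 < C" "\<And>m x y M. (\<And>j. j < m \<Longrightarrow> x j \<in> vecs (lp 1)) \<Longrightarrow> (\<And>j. j < m \<Longrightarrow> y j \<in> vecs E) \<Longrightarrow>
    (\<And>\<psi>. \<psi> \<in> vecs (dual E) \<Longrightarrow> vnorm (dual E) \<psi> \<le> 1 \<Longrightarrow> (\<Sum>j<m. norm (\<psi> (y j))) \<le> M) \<Longrightarrow>
    (\<Sum>j<m. norm (A (x j) (y j))) \<le> C * (weak_norm 2 (lp 1) m x * M)"
    using l1_form_sum_le[OF E type A] by blast
  have lin: "linear_form E (A z)" for z
    using A by (simp add: continuous_bilinear_forms_def)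
  have "(\<Sum>j<m. norm (A (x j) (y j)) powr r) powr (1 / r)
      \<le> C * (weak_norm 2 (lp 1) m x * weak_norm r E m y)"
    if xy: "\<forall>j<m. x j \<in> vecs (lp 1) \<and> y j \<in> vecs E" for m x y
  proof -
    define a where "a j = norm (A (x j) (y j))" for j
    define S where "S = (\<Sum>j<m. a j powr r)"
    define W w where "W = weak_norm 2 (lp 1) m x" and "w = weak_norm r E m y"
    have W: "0 \<le> W"
      unfolding W_def using normed_space.weak_norm_nonneg[OF normed_space_lp[of 1], of 2 m x] xy by simp
    have w: "0 \<le> w"
      unfolding w_def using weak_norm_nonneg[of r m y] xy r by simp
    have a: "0 \<le> a j" for j
      by (simp add: a_def)
    show ?thesis
    proof (cases "S = 0")
      case True
      then show ?thesis
        using C(1) W w by (simp flip: S_def a_def W_def w_def)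
    next
      case False
      then have S: "S > 0"
        by (simp add: S_def sum_nonneg order_less_le)
      have Holder: "(\<Sum>j<m. a j powr (r - 1) * z j) \<le> S powr (1 - 1 / r) * (\<Sum>j<m. z j powr r) powr (1 / r)"
        if z: "\<And>j. 0 \<le> z j" for z :: "nat \<Rightarrow> real"
      proof (cases "r = 1")
        case True
        \<comment> \<open>As \<open>0 powr 0 = 0\<close>, the weights here are \<open>0\<close> or
          \<open>1\<close>, hence an inequality.\<close>
        have "(\<Sum>j<m. a j powr (r - 1) * z j) \<le> (\<Sum>j<m. z j)"
          using True z by (intro sum_mono) (auto simp: mult_left_le_one_le)
        then show ?thesis
          using True S z by (simp add: sum_nonneg)
      next
        case False
        then have r1: "r > 1"
          using r by simp
        \<comment> \<open>The exponent conjugate to \<open>r\<close>; by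
          \<open>(r - 1) * q = r\<close> the first Hoelder factor is a power of
          \<open>S\<close>.\<close>
        define q where "q = r / (r - 1)"
        have q: "1 < q" "1 / q + 1 / r = 1" "(r - 1) * q = r" "1 / q = 1 - 1 / r"
          using r1 by (auto simp: q_def field_simps)
        have "(\<Sum>j<m. a j powr (r - 1) * z j)
            \<le> (\<Sum>j<m. (a j powr (r - 1)) powr q) powr (1 / q) * (\<Sum>j<m. z j powr r) powr (1 / r)"
          using q(1,2) r1 z by (intro Holder_sum) auto
        then show ?thesis
          unfolding S_def powr_powr q(3,4) .
      qed
      define y' where "y' j = smul E (of_real (a j powr (r - 1))) (y j)" for j
      have apply_y': "norm (f (y' j)) = a j powr (r - 1) * norm (f (y j))"
        if "linear_form E f" "j < m" for f j
      proof -
        have "f (y' j) = of_real (a j powr (r - 1)) * f (y j)"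
          using that xy by (simp add: linear_form_def y'_def)
        then show ?thesis
          by (simp only: norm_mult norm_of_real) simp
      qed
      \<comment> \<open>\<open>S\<close> is itself the sum for the rescaled family, while its bound
        contains only \<open>S powr (1 - 1 / r)\<close>; dividing by this power leaves the
        claim.\<close>
      have "S = (\<Sum>j<m. norm (A (x j) (y' j)))"
        unfolding S_def
      proof (rule sum.cong[OF refl])
        fix j assume "j \<in> {..<m}"
        then have "norm (A (x j) (y' j)) = a j powr (r - 1) * a j"
          using apply_y'[OF lin] by (simp add: a_def)
        also have "\<dots> = a j powr r"
          using a[of j] by (cases "a j = 0") (simp_all add: powr_diff)
        finally show "a j powr r = norm (A (x j) (y' j))" ..
      qed
      also have "\<dots> \<le> C * (W * (S powr (1 - 1 / r) * w))"
        unfolding W_def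
      proof (rule C(2))
        show "x j \<in> vecs (lp 1)" "y' j \<in> vecs E" if "j < m" for j
          using that xy by (simp_all add: y'_def smul_mem)
        fix \<psi> assume \<psi>: "\<psi> \<in> vecs (dual E)" "vnorm (dual E) \<psi> \<le> 1"
        then have "(\<Sum>j<m. norm (\<psi> (y' j))) = (\<Sum>j<m. a j powr (r - 1) * norm (\<psi> (y j)))"
          using apply_y' by (simp add: mem_dual_iff)
        also have "\<dots> \<le> S powr (1 - 1 / r) * (\<Sum>j<m. norm (\<psi> (y j)) powr r) powr (1 / r)"
          by (intro Holder) simp
        also have "\<dots> \<le> S powr (1 - 1 / r) * w"
          unfolding w_def using xy r \<psi> by (intro mult_left_mono weak_norm_upper) auto
        finally show "(\<Sum>j<m. norm (\<psi> (y' j))) \<le> S powr (1 - 1 / r) * w" .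
      qed
      also have "\<dots> = C * (W * w) * S powr (1 - 1 / r)"
        by simp
      finally have "S powr (1 / r) * S powr (1 - 1 / r) \<le> C * (W * w) * S powr (1 - 1 / r)"
        using S by (simp flip: powr_add)
      then have "S powr (1 / r) \<le> C * (W * w)"
        using S by simp
      then show ?thesis
        by (simp add: S_def a_def W_def w_def)
    qed
  qed
  then show ?thesis
    using A C(1) by (auto simp: summing_forms_def)
qed

text \<open>The inclusion from right to left is built into \<open>summing_forms\<close>.\<close>

lemma continuous_bilinear_forms_l1_eq_summing_forms:
  fixes E :: "('k::real_or_complex, 'b::ab_group_add) nspace"
  assumes "normed_space E" "has_type 2 (dual E)" "1 \<le> r"
  shows "continuous_bilinear_forms (lp 1) E = summing_forms r 2 r (lp 1) E"
  using continuous_form_on_l1_summing[OF assms] by (auto simp: summing_forms_def)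

theorem proposition4p1:
  shows
   "(\<forall>(E :: ('k::real_or_complex, 'e::ab_group_add) nspace) r.
       banach_space E \<and> has_type 2 (dual E) \<and> 1 \<le> r \<and> r \<le> 2 \<longrightarrow>
         continuous_bilinear_forms (lp 1 :: ('k, nat \<Rightarrow> 'k) nspace) E = summing_forms 1 2 1 (lp 1) E \<and>
         summing_forms 1 2 1 (lp 1 :: ('k, nat \<Rightarrow> 'k) nspace) E = summing_forms r 2 r (lp 1) E) \<and>
    (\<forall>q r. 1 < q \<and> q \<le> 2 \<and> 1 \<le> r \<and> r \<le> 2 \<longrightarrow>
       continuous_bilinear_forms (lp 1 :: ('k, nat \<Rightarrow> 'k) nspace) (lp q) = summing_forms 1 2 1 (lp 1) (lp q) \<and>
       summing_forms 1 2 1 (lp 1 :: ('k, nat \<Rightarrow> 'k) nspace) (lp q) = summing_forms r 2 r (lp 1) (lp q))"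
proof (intro conjI allI impI; elim conjE)
  fix E :: "('k, 'e) nspace" and r :: real
  assume "banach_space E" and type: "has_type 2 (dual E)" and r: "1 \<le> r"
  then have E: "normed_space E"
    by (simp add: banach_space_def)
  \<comment> \<open>Exponent \<open>1\<close> and exponent \<open>r\<close> are two instances of one
    equation, which together give both equalities.\<close>
  note eq = continuous_bilinear_forms_l1_eq_summing_forms[OF E type]
  show "continuous_bilinear_forms (lp 1) E = summing_forms 1 2 1 (lp 1) E"
    by (rule eq) simp
  then show "summing_forms 1 2 1 (lp 1) E = summing_forms r 2 r (lp 1) E"
    using eq[OF r] by simp
next
  fix q r :: real
  assume q: "1 < q" "q \<le> 2" and r: "1 \<le> r"
  have "normed_space (lp q :: ('k, nat \<Rightarrow> 'k) nspace)"
    using q by (intro normed_space_lp) simp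
  note eq = continuous_bilinear_forms_l1_eq_summing_forms[OF this dual_lp_type_2[OF q]]
  show "continuous_bilinear_forms (lp 1 :: ('k, nat \<Rightarrow> 'k) nspace) (lp q) = summing_forms 1 2 1 (lp 1) (lp q)"
    by (rule eq) simp
  then show "summing_forms 1 2 1 (lp 1 :: ('k, nat \<Rightarrow> 'k) nspace) (lp q) = summing_forms r 2 r (lp 1) (lp q)"
    using eq[OF r] by simp
qed

end
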